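(* Let $m$ be a positive integer, let $\alpha\in[0,1]$ and $\beta > 0$, and let $\Phi = \{F_1,\ldots,F_N\}$ be an iterated function system on $\mathbf{R}$ consisting of contracting $C^{1+\beta}$-diffeomorphisms. Let $E$ be the attractor of $\Phi$ and assume that the interiors of the convex hulls of $F_i(E)$ and $F_j(E)$ are disjoint whenever $i\neq j$. Let $s\in[0,1]$ and let $\lambda$ be a Borel probability measure on $E$ for which there is a constant $A$ such that $\lambda(I)\leq A|I|^s$ for every interval $I$. With $(\Omega,P)$ and $f_\omega$ constructed from $E$, $m$ and $\alpha$ as in the context, for $P$-almost every $\omega\in\Omega$, $$\dim_{\mathrm{F}} f_\omega\lambda \geq \frac{s}{m+\alpha}.$$
   Context: The Fourier transform of a Borel probability measure $\mu$ on $\mathbf{R}$ is $\widehat\mu(\xi) = \int e^{-2\pi i \xi x}\,\mathrm{d}\mu(x)$. The Fourier dimension of $\mu$ is $\dim_{\mathrm{F}} \mu = \sup\{ s \in [0,1] : |\widehat\mu(\xi)|\,|\xi|^{s/2} \text{ is bounded in } \xi\}$. The attractor of $\Phi$ is the unique non-empty compact set $E$ with $E = \bigcup_{i=1}^N F_i(E)$. A $C^{1+\beta}$-diffeomorphism is a $C^1$-diffeomorphism whose derivative is Hölder continuous with exponent $\beta$. For an interval $I$, $|I|$ denotes its length, and $\lambda(I)$ means $\lambda(I\cap E)$; by convention $0^0=1$. Construction of $f_\omega$: let $D$ be the (countable) set of bounded connected components of $\mathbf{R}\setminus E$. Define, for $t>0$, $$\delta(t) = \frac{1}{\max(-\log t,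 \log 2)} \ \text{ if } \alpha = 0, \qquad \delta(t) = t^\alpha \ \text{ if } \alpha\in(0,1],$$ and put $\delta_U = |U|^m\,\delta(|U|)$ for $U\in D$. Let $\Omega = \prod_{U\in D}[0,\delta_U]$. For $\omega = (\omega_U)_{U\in D}\in\Omega$ define $f_\omega : E\to\mathbf{R}$ by $$f_\omega(x) = x + \sum_{U\in D,\ U\subset(-\infty,x)}\omega_U.$$ Fix a Borel probability measure $\nu$ on $[0,1]$ such that $\lim_{|\xi|\to\infty}\widehat\nu(\xi) = 0$, let $\nu_U$ be the image of $\nu$ under the map $x\mapsto\delta_U x$, and let $P$ be the product measure $\prod_{U\in D}\nu_U$ on $\Omega$. The measure $f_\omega\lambda$ is the push-forward of $\lambda$ by $f_\omega$: $(f_\omega\lambda)(B) = \lambda(f_\omega^{-1}(B))$ for Borel sets $B$.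
   Formalization: The attractor E is additionally assumed not to be a non-degenerate closed interval; for E=[0,1] there are no gaps, f_ω is the identity, and the claim fails, for example for the middle-third Cantor measure, whose Fourier dimension is 0. *)

theory Defs
  imports "HOL-Probability.Probability"
begin

(* In the library 0 powr 0 = 0, whereas here 0^0 = 1. *)
definition rpow :: "real \<Rightarrow> real \<Rightarrow> real" where
  "rpow x y = (if x = 0 \<and> y = 0 then 1 else x powr y)"

definition fourier_transform :: "real measure \<Rightarrow> real \<Rightarrow> complex" where
  "fourier_transform \<mu> \<xi> = (CLINT x|\<mu>. exp (- 2 * of_real pi * \<i> * of_real \<xi> * of_real x))"

(* For a probability measure the set below contains 0, so the real supremum is meaningful. *)
definition fourier_dim :: "real measure \<Rightarrow> real" where
  "fourier_dim \<mu> =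
     Sup {s \<in> {0..1}. bounded (range (\<lambda>\<xi>. norm (fourier_transform \<mu> \<xi>) * rpow \<bar>\<xi>\<bar> (s / 2)))}"

definition contracting :: "(real \<Rightarrow> real) \<Rightarrow> bool" where
  "contracting g \<longleftrightarrow> (\<exists>c<1. c-lipschitz_on UNIV g)"

definition C1_diffeo :: "(real \<Rightarrow> real) \<Rightarrow> bool" where
  "C1_diffeo g \<longleftrightarrow> bij g \<and> g C1_differentiable_on UNIV \<and> inv g C1_differentiable_on UNIV"

definition holder_continuous :: "real \<Rightarrow> (real \<Rightarrow> real) \<Rightarrow> bool" where
  "holder_continuous \<beta> g \<longleftrightarrow> (\<exists>C. \<forall>x y. \<bar>g x - g y\<bar> \<le> C * \<bar>x - y\<bar> powr \<beta>)"

definition C1_holder_diffeo :: "real \<Rightarrow> (real \<Rightarrow> real) \<Rightarrow> bool" where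
  "C1_holder_diffeo \<beta> g \<longleftrightarrow> C1_diffeo g \<and> holder_continuous \<beta> (deriv g)"

(* For contracting maps there is exactly one such set (Hutchinson), so this determines E. *)
definition is_attractor :: "nat \<Rightarrow> (nat \<Rightarrow> real \<Rightarrow> real) \<Rightarrow> real set \<Rightarrow> bool" where
  "is_attractor N F E \<longleftrightarrow> E \<noteq> {} \<and> compact E \<and> E = (\<Union>i\<in>{1..N}. F i ` E)"

definition gaps :: "real set \<Rightarrow> real set set" where
  "gaps E = {U \<in> components (- E). bounded U}"

abbreviation len :: "real set \<Rightarrow> real" where
  "len I \<equiv> measure lborel I"

definition delta :: "real \<Rightarrow> real \<Rightarrow> real" where
  "delta \<alpha> t = (if \<alpha> = 0 then 1 / max (- ln t) (ln 2) else t powr \<alpha>)"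

definition gap_delta :: "nat \<Rightarrow> real \<Rightarrow> real set \<Rightarrow> real" where
  "gap_delta m \<alpha> U = len U ^ m * delta \<alpha> (len U)"

definition Omega :: "nat \<Rightarrow> real \<Rightarrow> real set \<Rightarrow> (real set \<Rightarrow> real) set" where
  "Omega m \<alpha> E = (\<Pi>\<^sub>E U\<in>gaps E. {0..gap_delta m \<alpha> U})"

definition f_map :: "real set \<Rightarrow> (real set \<Rightarrow> real) \<Rightarrow> real \<Rightarrow> real" where
  "f_map E \<omega> x = x + (\<Sum>\<^sub>\<infinity>U\<in>{U \<in> gaps E. U \<subseteq> {..<x}}. \<omega> U)"

definition P_measure ::
    "nat \<Rightarrow> real \<Rightarrow> real set \<Rightarrow> real measure \<Rightarrow> (real set \<Rightarrow> real) measure" where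
  "P_measure m \<alpha> E \<nu> =
     (\<Pi>\<^sub>M U\<in>gaps E. distr \<nu> (restrict_space borel {0..gap_delta m \<alpha> U}) (\<lambda>x. gap_delta m \<alpha> U * x))"

definition borel_prob_on :: "real set \<Rightarrow> real measure \<Rightarrow> bool" where
  "borel_prob_on S \<mu> \<longleftrightarrow> prob_space \<mu> \<and> sets \<mu> = sets (restrict_space borel S)"

lemma gap_delta_nonneg: "0 \<le> gap_delta m \<alpha> U"
proof -
  have "0 < max (- ln (len U)) (ln 2)"
    by (simp add: less_max_iff_disj)
  then show ?thesis
    by (auto simp: gap_delta_def delta_def intro!: mult_nonneg_nonneg divide_nonneg_pos)
qed

lemma space_P_measure: "space (P_measure m \<alpha> E \<nu>) = Omega m \<alpha> E"
  by (simp add: P_measure_def Omega_def space_PiM space_restrict_space)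

lemma prob_space_P_measure:
  assumes "borel_prob_on {0..1} \<nu>"
  shows "prob_space (P_measure m \<alpha> E \<nu>)"
  unfolding P_measure_def
proof (intro prob_space_PiM prob_space.prob_space_distr)
  fix U
  have s: "sets \<nu> = sets (restrict_space borel {0..1})" and p: "prob_space \<nu>"
    using assms by (auto simp: borel_prob_on_def)
  show "prob_space \<nu>" by (fact p)
  have "(\<lambda>x. gap_delta m \<alpha> U * x)
      \<in> restrict_space borel {0..1} \<rightarrow>\<^sub>M restrict_space borel {0..gap_delta m \<alpha> U}"
    by (intro measurable_restrict_space3)
       (auto intro!: mult_nonneg_nonneg mult_left_le gap_delta_nonneg)
  then show "(\<lambda>x. gap_delta m \<alpha> U * x) \<in> \<nu> \<rightarrow>\<^sub>M restrict_space borel {0..gap_delta m \<alpha> U}"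
    using measurable_cong_sets[OF s refl] by blast
qed

end

theory Submission
  imports Defs
begin

text \<open>
  Bounded distortion makes \<open>E\<close> porous: between any two points \<open>a < b\<close> of \<open>E\<close> there is a gap of
  length at least \<open>\<kappa> * (b - a)\<close>. Hence a set of points of \<open>E\<close> not separated by gaps of length
  \<open>\<ge> \<rho>\<close> has diameter at most \<open>\<rho> / \<kappa>\<close>, and so \<open>lam\<close>-measure \<open>O(\<rho> powr s)\<close>.

  Expanding the moment of order \<open>2q\<close> of the transform of the image measure at \<open>\<xi>\<close> as an integral over
  \<open>2q\<close> points, the expectation factorises over the gaps; a gap contributes a factor at most
  \<open>1/2\<close> as soon as it has an odd number of the points to its right and \<open>gap_delta U * \<bar>\<xi>\<bar>\<close> is large,
  which holds for all gaps of length at least some \<open>\<rho>\<close> with \<open>\<rho> powr (m + \<alpha> + \<eta>) = O(1 / \<bar>\<xi>\<bar>)\<close>. Removing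
  the two smallest points again and again bounds the integral by \<open>C q * \<rho> powr (s * q)\<close>. Summing
  high moments over \<open>\<xi> = sqrt k\<close> gives almost sure decay on this grid, and the transform is Lipschitz.
\<close>


section \<open>Porosity of self-conformal attractors\<close>

text \<open>The exponent is a count of pairs. Every large gap with an odd number of points to its
  right costs a factor \<open>1/2\<close>, so \<open>2q\<close> points keep a sizeable expectation
  only if they cluster in pairs at scale \<open>\<rho>\<close>, and each pair costs about
  \<open>\<rho> powr s\<close>. Thus the transform has size about \<open>\<rho> powr (s / 2)\<close>
  with \<open>\<rho>\<close> close to \<open>\<bar>\<xi>\<bar> powr (- 1 / (m + \<alpha>))\<close>,
  which matches the exponent \<open>s / 2\<close> in \<open>fourier_dim\<close>. Parity decides
  because the frequency at a gap is a count of points with signs \<open>+1\<close> and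
  \<open>-1\<close>, the latter from conjugate factors: an even number of signs may cancel to zero,
  an odd number cannot. A gap gives only the fixed factor \<open>1/2\<close>; the power of
  \<open>\<xi>\<close> comes from the small measure of clustered configurations. The loss
  \<open>\<eta>\<close> absorbs the logarithm at \<open>\<alpha> = 0\<close>. Moments of high order
  are forced by the sum over the grid: the closer the exponent is to
  \<open>s / (m + \<alpha>)\<close>, the larger \<open>q\<close> must be for that sum to
  converge.\<close>

lemma gap_containing:
  fixes E :: "real set"
  assumes "a \<in> E" "b \<in> E" "closed E" "r < t" "{r<..<t} \<subseteq> {a<..<b}" "{r<..<t} \<inter> E = {}"
  shows "\<exists>U\<in>gaps E. U \<subseteq> {a<..<b} \<and> t - r \<le> len U"
proof -
  define U where "U = connected_component_set (- E) ((r + t) / 2)"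
  have mid: "(r + t) / 2 \<in> {r<..<t}" using assms(4) by auto
  have sub: "{r<..<t} \<subseteq> U"
    unfolding U_def using mid assms(6) by (intro connected_component_maximal) auto
  have U_comp: "U \<in> components (- E)"
    using mid assms(6) unfolding U_def components_def by blast
  have conn: "connected U" and U_E: "U \<inter> E = {}"
    using U_comp in_components_connected in_components_subset by blast+
  have "is_interval U" using conn by (simp add: is_interval_connected_1)
  \<comment> \<open>An interval through the midpoint that avoids \<open>a\<close> and
    \<open>b\<close> cannot pass them. This makes the component bounded, hence a gap.\<close>
  have bd: "U \<subseteq> {a<..<b}"
  proof
    fix x assume x: "x \<in> U"
    have m: "(r + t) / 2 \<in> U" "a < (r + t) / 2" "(r + t) / 2 < b" using sub mid subsetD[OF assms(5) mid] by auto
    have "a \<notin> U" "b \<notin> U" using U_E assms(1,2) by auto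
    then show "x \<in> {a<..<b}"
      using \<open>is_interval U\<close> m x unfolding is_interval_1
      by (metis greaterThanLessThan_iff linorder_le_less_linear order_less_imp_le)
  qed
  then have "bounded U" using bounded_subset[OF bounded_box] by (metis box_real(1))
  moreover have "open U" using U_comp assms(3) open_components[of "- E" U] by auto
  then have "U \<in> fmeasurable lborel"
    using emeasure_bounded_finite[OF \<open>bounded U\<close>] by (intro fmeasurableI) auto
  then have "t - r \<le> len U"
    using sub assms(4) measure_mono_fmeasurable[of "{r<..<t}" U lborel] by simp
  ultimately show ?thesis using U_comp bd unfolding gaps_def by auto
qed

text \<open>The derivative cannot vanish because the inverse is differentiable too: the chain rule
  for \<open>inv g \<circ> g = id\<close> gives a product equal to 1.\<close>

lemma C1_diffeo_props:
  assumes "C1_diffeo g"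
  shows "inj g" "\<And>x. (g has_real_derivative deriv g x) (at x)" "\<And>x. deriv g x \<noteq> 0"
    "continuous_on UNIV (deriv g)"
proof -
  have bij: "bij g" and g1: "g C1_differentiable_on UNIV" and g2: "inv g C1_differentiable_on UNIV"
    using assms by (auto simp: C1_diffeo_def)
  show "inj g" using bij by (rule bij_is_inj)
  obtain D where D: "\<And>x. (g has_vector_derivative D x) (at x)" "continuous_on UNIV D"
    using g1 unfolding C1_differentiable_on_def by auto
  have D': "(g has_real_derivative D x) (at x)" for x
    using D(1) by (simp add: has_real_derivative_iff_has_vector_derivative)
  then have dD: "deriv g = D" using DERIV_imp_deriv by blast
  show "\<And>x. (g has_real_derivative deriv g x) (at x)" "continuous_on UNIV (deriv g)"
    using D' D dD by auto
  obtain D2 where D2: "\<And>x. (inv g has_vector_derivative D2 x) (at x)"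
    using g2 unfolding C1_differentiable_on_def by auto
  fix x
  have "((inv g \<circ> g) has_real_derivative D2 (g x) * D x) (at x)"
    using D' D2 by (intro DERIV_chain) (auto simp: has_real_derivative_iff_has_vector_derivative)
  moreover have "inv g \<circ> g = id" using \<open>inj g\<close> by simp
  ultimately have "D2 (g x) * D x = 1" using DERIV_unique[of "\<lambda>x. x", OF _ DERIV_ident] by (simp add: id_def)
  then show "deriv g x \<noteq> 0" using dD by auto
qed

text \<open>A continuous injection of the line is monotone, but possibly decreasing. Segments with
  unordered endpoints spare a case distinction on orientation throughout.\<close>

lemma closed_segment_inj_image:
  fixes g :: "real \<Rightarrow> real"
  assumes "inj g" "continuous_on UNIV g" "z \<in> closed_segment x y"
  shows "g z \<in> closed_segment (g x) (g y)"
proof -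
  have *: "g z \<in> closed_segment (g x) (g y)" if "x \<le> z" "z \<le> y" for x y
  proof (cases "z = x \<or> z = y")
    case False
    then have "x < z" "z < y" using that by auto
    then have "(g x < g z \<and> g z < g y) \<or> (g y < g z \<and> g z < g x)"
      using assms(1,2) by (intro continuous_inj_imp_mono)
        (auto intro: continuous_on_subset inj_on_subset)
    then show ?thesis by (auto simp: closed_segment_eq_real_ivl)
  qed auto
  show ?thesis
    using assms(3) *[of x y] *[of y x]
    by (auto simp: closed_segment_eq_real_ivl closed_segment_commute split: if_splits)
qed

text \<open>Both difference quotients are values of the derivative at points of the same segment, so
  Hoelder continuity and a positive lower bound for \<open>\<bar>deriv g\<bar>\<close> on
  \<open>{p..q}\<close> control their ratio. Multiplying out the quotients admits degenerate
  segments, and the exponential turns composition of maps into addition of exponents.\<close>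

lemma C1_holder_diffeo_distortion:
  assumes "C1_holder_diffeo \<beta> g" and "\<beta> > 0"
  shows "\<exists>C\<ge>0. \<forall>x\<in>{p..q}. \<forall>y\<in>{p..q}. \<forall>x'\<in>closed_segment x y. \<forall>y'\<in>closed_segment x y.
    \<bar>g x - g y\<bar> * \<bar>x' - y'\<bar> \<le> exp (C * \<bar>x - y\<bar> powr \<beta>) * \<bar>g x' - g y'\<bar> * \<bar>x - y\<bar>"
proof -
  have C1: "C1_diffeo g" and "holder_continuous \<beta> (deriv g)"
    using assms by (auto simp: C1_holder_diffeo_def)
  note g = C1_diffeo_props[OF C1]
  obtain H0 where H0: "\<And>x y. \<bar>deriv g x - deriv g y\<bar> \<le> H0 * \<bar>x - y\<bar> powr \<beta>"
    using \<open>holder_continuous \<beta> (deriv g)\<close> unfolding holder_continuous_def by auto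
  define H where "H = max H0 0"
  have H: "\<bar>deriv g x - deriv g y\<bar> \<le> H * \<bar>x - y\<bar> powr \<beta>" for x y
    by (rule order_trans[OF H0]) (auto simp: H_def intro!: mult_right_mono)
  have "compact ((\<lambda>x. \<bar>deriv g x\<bar>) ` {p..q})"
    using g(4) by (intro compact_continuous_image continuous_intros) (auto intro: continuous_on_subset)
  moreover have "0 \<notin> (\<lambda>x. \<bar>deriv g x\<bar>) ` {p..q}" using g(3) by auto
  ultimately obtain d where d: "d > 0" "\<And>x. x \<in> {p..q} \<Longrightarrow> d \<le> \<bar>deriv g x\<bar>"
    using separate_point_closed[of "(\<lambda>x. \<bar>deriv g x\<bar>) ` {p..q}" 0]
    by (auto simp: compact_imp_closed)
  have mvt: "\<exists>z\<in>closed_segment x y. \<bar>g x - g y\<bar> = \<bar>deriv g z\<bar> * \<bar>x - y\<bar>" for x y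
  proof -
    have *: "\<exists>z\<in>closed_segment x y. \<bar>g x - g y\<bar> = \<bar>deriv g z\<bar> * \<bar>x - y\<bar>" if xy: "x < y" for x y
    proof -
      obtain z where "z > x" "z < y" "g y - g x = (y - x) * deriv g z"
        using MVT2[OF xy, of g "deriv g"] g(2) by auto
      moreover from this have "\<bar>g x - g y\<bar> = \<bar>deriv g z\<bar> * \<bar>x - y\<bar>"
        by (metis abs_minus_commute abs_mult mult.commute)
      ultimately show ?thesis
        using xy by (intro bexI[of _ z]) (auto simp: closed_segment_eq_real_ivl)
    qed
    show ?thesis using *[of x y] *[of y x]
      by (cases x y rule: linorder_cases) (auto simp: abs_minus_commute closed_segment_commute)
  qed
  show ?thesis
  proof (intro exI[of _ "H / d"] conjI ballI)
    show "0 \<le> H / d" using d by (simp add: H_def)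
    fix x y x' y' assume xy: "x \<in> {p..q}" "y \<in> {p..q}" and xy': "x' \<in> closed_segment x y" "y' \<in> closed_segment x y"
    obtain z where z: "z \<in> closed_segment x y" "\<bar>g x - g y\<bar> = \<bar>deriv g z\<bar> * \<bar>x - y\<bar>" using mvt by blast
    obtain z' where z': "z' \<in> closed_segment x' y'" "\<bar>g x' - g y'\<bar> = \<bar>deriv g z'\<bar> * \<bar>x' - y'\<bar>" using mvt by blast
    have z'2: "z' \<in> closed_segment x y" using z'(1) xy' by (meson convex_closed_segment closed_segment_subset subsetD)
    then have "z' \<in> {p..q}" using xy by (auto simp: closed_segment_eq_real_ivl split: if_splits)
    have zz: "\<bar>z - z'\<bar> \<le> \<bar>x - y\<bar>"
      using z(1) z'2 by (auto simp: closed_segment_eq_real_ivl split: if_splits)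
    have "\<bar>deriv g z\<bar> \<le> \<bar>deriv g z'\<bar> + \<bar>deriv g z - deriv g z'\<bar>" by linarith
    also have "\<dots> \<le> \<bar>deriv g z'\<bar> + H * \<bar>x - y\<bar> powr \<beta>"
      using H[of z z'] powr_mono2[of \<beta>, OF _ _ zz] assms(2)
      by (smt (verit) H_def mult_left_mono)
    also have "\<dots> \<le> \<bar>deriv g z'\<bar> + \<bar>deriv g z'\<bar> / d * H * \<bar>x - y\<bar> powr \<beta>"
    proof -
      have "1 \<le> \<bar>deriv g z'\<bar> / d" using d \<open>z' \<in> {p..q}\<close> by auto
      then have "1 * (H * \<bar>x - y\<bar> powr \<beta>) \<le> \<bar>deriv g z'\<bar> / d * (H * \<bar>x - y\<bar> powr \<beta>)"
        by (intro mult_right_mono) (auto simp: H_def)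
      then show ?thesis by (simp add: mult.assoc)
    qed
    also have "\<dots> = (1 + H / d * \<bar>x - y\<bar> powr \<beta>) * \<bar>deriv g z'\<bar>" using d(1) by (simp add: field_simps)
    also have "\<dots> \<le> exp (H / d * \<bar>x - y\<bar> powr \<beta>) * \<bar>deriv g z'\<bar>"
      by (intro mult_right_mono exp_ge_add_one_self) auto
    finally have "\<bar>deriv g z\<bar> * (\<bar>x - y\<bar> * \<bar>x' - y'\<bar>) \<le> exp (H / d * \<bar>x - y\<bar> powr \<beta>) * \<bar>deriv g z'\<bar> * (\<bar>x - y\<bar> * \<bar>x' - y'\<bar>)"
      by (intro mult_right_mono) auto
    then show "\<bar>g x - g y\<bar> * \<bar>x' - y'\<bar> \<le> exp (H / d * \<bar>x - y\<bar> powr \<beta>) * \<bar>g x' - g y'\<bar> * \<bar>x - y\<bar>"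
      using z(2) z'(2) by (simp add: algebra_simps)
  qed
qed

text \<open>If the middle third of \<open>{a..b}\<close> misses \<open>E\<close>, it lies in a gap. Otherwise some cylinder of
  length comparable to but below \<open>(b - a) / 3\<close> meets it, hence lies in \<open>{a<..<b}\<close>; by bounded
  distortion the cylinder contains the image of a fixed gap \<open>{u<..<v}\<close> at comparable scale, and
  by the disjointness of the hulls no other piece of \<open>E\<close> enters it.\<close>
lemma attractor_porous:
  fixes F :: "nat \<Rightarrow> real \<Rightarrow> real"
  assumes \<beta>: "\<beta> > 0"
    and maps: "\<And>i. i \<in> {1..N} \<Longrightarrow> contracting (F i) \<and> C1_holder_diffeo \<beta> (F i)"
    and attr: "is_attractor N F E"
    and disj: "\<And>i j. i \<in> {1..N} \<Longrightarrow> j \<in> {1..N} \<Longrightarrow> i \<noteq> j \<Longrightarrow>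
           interior (convex hull (F i ` E)) \<inter> interior (convex hull (F j ` E)) = {}"
    and nint: "\<nexists>a b. a < b \<and> E = {a..b}"
  shows "\<exists>\<kappa>>0. \<forall>a\<in>E. \<forall>b\<in>E. a < b \<longrightarrow> (\<exists>U\<in>gaps E. U \<subseteq> {a<..<b} \<and> \<kappa> * (b - a) \<le> len U)"
proof -
  define I where "I = {1..N}"
  define p where "p = Inf E"
  define q where "q = Sup E"
  have "E \<noteq> {}" "compact E" and E_eq: "E = (\<Union>i\<in>I. F i ` E)"
    using attr by (auto simp: is_attractor_def I_def)
  then have "closed E" "bounded E" by (auto simp: compact_eq_bounded_closed)
  have pq: "p \<in> E" "q \<in> E"
    unfolding p_def q_def using \<open>E \<noteq> {}\<close> \<open>closed E\<close> \<open>bounded E\<close>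
    by (auto intro!: closed_contains_Inf closed_contains_Sup bounded_imp_bdd_below bounded_imp_bdd_above)
  have EK: "E \<subseteq> {p..q}"
    unfolding p_def q_def using \<open>bounded E\<close>
    by (auto intro!: cInf_lower cSup_upper bounded_imp_bdd_below bounded_imp_bdd_above)
  show ?thesis
  proof (cases "p < q")
    case False
    have "\<not> a < b" if "a \<in> E" "b \<in> E" for a b
      using False subsetD[OF EK that(1)] subsetD[OF EK that(2)] by auto
    then show ?thesis by (intro exI[of _ 1]) auto
  next
    case True
    have inj: "inj (F i)" and cont: "continuous_on UNIV (F i)" if "i \<in> I" for i
    proof -
      have *: "C1_diffeo (F i)" using maps that by (auto simp: C1_holder_diffeo_def I_def)
      show "inj (F i)" by (rule C1_diffeo_props(1)[OF *])
      show "continuous_on UNIV (F i)"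
        using C1_diffeo_props(2)[OF *] by (meson DERIV_isCont continuous_at_imp_continuous_on)
    qed
    have seg: "F i z \<in> closed_segment (F i x) (F i y)" if "i \<in> I" "z \<in> closed_segment x y" for i x y z
      using closed_segment_inj_image inj cont that by blast
    have FE: "F i x \<in> E" if "i \<in> I" "x \<in> E" for i x
      using E_eq that by blast
    have FK: "F i x \<in> {p..q}" if "i \<in> I" "x \<in> {p..q}" for i x
    proof -
      have "F i x \<in> closed_segment (F i p) (F i q)"
        using that True by (intro seg) (auto simp: closed_segment_eq_real_ivl)
      then show ?thesis using FE[OF that(1) pq(1)] FE[OF that(1) pq(2)] EK
        by (auto simp: closed_segment_eq_real_ivl split: if_splits)
    qed

    \<comment> \<open>Constants common to all maps\<close>
    have "\<forall>i\<in>I. \<exists>C. C \<ge> 0 \<and> (\<forall>x\<in>{p..q}. \<forall>y\<in>{p..q}. \<forall>x'\<in>closed_segment x y. \<forall>y'\<in>closed_segment x y.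
        \<bar>F i x - F i y\<bar> * \<bar>x' - y'\<bar> \<le> exp (C * \<bar>x - y\<bar> powr \<beta>) * \<bar>F i x' - F i y'\<bar> * \<bar>x - y\<bar>)"
      using C1_holder_diffeo_distortion[OF _ \<beta>] maps unfolding I_def by fast
    from bchoice[OF this] obtain Cf where Cf: "\<And>i. i \<in> I \<Longrightarrow> Cf i \<ge> 0 \<and> (\<forall>x\<in>{p..q}. \<forall>y\<in>{p..q}. \<forall>x'\<in>closed_segment x y. \<forall>y'\<in>closed_segment x y.
        \<bar>F i x - F i y\<bar> * \<bar>x' - y'\<bar> \<le> exp (Cf i * \<bar>x - y\<bar> powr \<beta>) * \<bar>F i x' - F i y'\<bar> * \<bar>x - y\<bar>)"
      by blast
    define C where "C = (\<Sum>i\<in>I. Cf i)"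
    have C0: "C \<ge> 0" unfolding C_def using Cf by (auto intro: sum_nonneg)
    have dist1: "\<bar>F i x - F i y\<bar> * \<bar>x' - y'\<bar> \<le> exp (C * \<bar>x - y\<bar> powr \<beta>) * \<bar>F i x' - F i y'\<bar> * \<bar>x - y\<bar>"
      if "i \<in> I" "x \<in> {p..q}" "y \<in> {p..q}" "x' \<in> closed_segment x y" "y' \<in> closed_segment x y" for i x y x' y'
    proof -
      have "Cf i \<le> C" unfolding C_def using that(1) Cf by (intro member_le_sum) (auto simp: I_def)
      then have "exp (Cf i * \<bar>x - y\<bar> powr \<beta>) \<le> exp (C * \<bar>x - y\<bar> powr \<beta>)"
        by (simp add: mult_right_mono)
      then have "exp (Cf i * \<bar>x - y\<bar> powr \<beta>) * \<bar>F i x' - F i y'\<bar> * \<bar>x - y\<bar>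
          \<le> exp (C * \<bar>x - y\<bar> powr \<beta>) * \<bar>F i x' - F i y'\<bar> * \<bar>x - y\<bar>"
        by (intro mult_right_mono) auto
      moreover have "\<bar>F i x - F i y\<bar> * \<bar>x' - y'\<bar> \<le> exp (Cf i * \<bar>x - y\<bar> powr \<beta>) * \<bar>F i x' - F i y'\<bar> * \<bar>x - y\<bar>"
        using Cf[OF that(1)] that(2-) by blast
      ultimately show ?thesis by linarith
    qed

    obtain cf where cf: "\<And>i. i \<in> I \<Longrightarrow> cf i < 1 \<and> (cf i)-lipschitz_on UNIV (F i)"
      using maps unfolding contracting_def I_def by metis
    \<comment> \<open>The inserted \<open>1/2\<close> makes \<open>c\<close> positive, so that its
      powers with exponent \<open>\<beta>\<close> can be manipulated freely.\<close>
    define c where "c = Max (insert (1/2) (cf ` I))"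
    have c: "0 < c" "c < 1"
      unfolding c_def using cf by (auto simp: I_def Max_gr_iff)
    have cf_le: "cf i \<le> c" if "i \<in> I" for i
      unfolding c_def using that by (intro Max_ge) (auto simp: I_def)
    have contr: "\<bar>F i x - F i y\<bar> \<le> c * \<bar>x - y\<bar>" if "i \<in> I" for i x y
    proof -
      have "\<bar>F i x - F i y\<bar> \<le> cf i * \<bar>x - y\<bar>"
        using cf[OF that] lipschitz_onD[of "cf i" UNIV "F i" x y] by (auto simp: dist_real_def)
      also have "\<dots> \<le> c * \<bar>x - y\<bar>" using cf_le that by (intro mult_right_mono) auto
      finally show ?thesis .
    qed

    \<comment> \<open>Cylinder maps and their distortion\<close>
    define W where "W = foldr F"
    \<comment> \<open>The first letter is the outermost map, so inductions on words peel it off,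
      while appending a letter passes to a smaller cylinder inside the given one.\<close>
    have W_Nil: "W [] = id" and W_Cons: "W (i # w) x = F i (W w x)"
      and W_snoc: "W (w @ [i]) x = W w (F i x)" for i w x
      by (auto simp: W_def)
    have W_E: "W w x \<in> E" if "w \<in> lists I" "x \<in> E" for w x
      using that by (induction w) (auto simp: W_Nil W_Cons FE)
    have W_K: "W w x \<in> {p..q}" if "w \<in> lists I" "x \<in> {p..q}" for w x
      using that(1)
    proof (induction w)
      case (Cons i w)
      then show ?case using FK[of i "W w x"] unfolding W_Cons by blast
    qed (use that in \<open>simp add: W_Nil\<close>)
    have W_inj: "inj (W w)" if "w \<in> lists I" for w
      using that by (induction w) (auto simp: W_Nil W_Cons inj_on_def dest!: injD[OF inj])
    have W_cont: "continuous_on UNIV (W w)" if "w \<in> lists I" for w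
      using that
    proof (induction w)
      case (Cons i w)
      have "W (i # w) = F i \<circ> W w" by (auto simp: W_Cons)
      then show ?case using Cons cont[of i] by (auto intro!: continuous_on_compose2[of UNIV "F i"])
    qed (simp add: W_Nil continuous_on_id)
    have W_seg: "W w z \<in> closed_segment (W w x) (W w y)" if "w \<in> lists I" "z \<in> closed_segment x y" for w x y z
      using closed_segment_inj_image W_inj W_cont that by blast
    have W_contr: "\<bar>W w x - W w y\<bar> \<le> c ^ length w * \<bar>x - y\<bar>" if "w \<in> lists I" for w x y
      using that
    proof (induction w)
      case (Cons i w)
      have "\<bar>W (i # w) x - W (i # w) y\<bar> \<le> c * \<bar>W w x - W w y\<bar>"
        unfolding W_Cons using Cons by (intro contr) auto
      also have "\<dots> \<le> c * (c ^ length w * \<bar>x - y\<bar>)"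
        using Cons c by (intro mult_left_mono) auto
      finally show ?case by (simp add: mult_ac)
    qed (simp add: W_Nil)
    \<comment> \<open>Distortions multiply along the word. The map applied after \<open>k\<close>
      others acts on a segment of length at most \<open>c ^ k * \<bar>x - y\<bar>\<close>, so the
      exponents are dominated by a geometric series that does not depend on the word.\<close>
    have W_dist: "\<bar>W w x - W w y\<bar> * \<bar>x' - y'\<bar>
        \<le> exp (\<Sum>k<length w. C * (c ^ k * \<bar>x - y\<bar>) powr \<beta>) * \<bar>W w x' - W w y'\<bar> * \<bar>x - y\<bar>"
      if "w \<in> lists I" and x: "x \<in> {p..q}" "y \<in> {p..q}" "x' \<in> closed_segment x y" "y' \<in> closed_segment x y" for w x y x' y'
      using that(1)
    proof (induction w)
      case (Cons i w)
      have w: "w \<in> lists I" "i \<in> I" using Cons by auto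
      show ?case
      proof (cases "x' = y'")
        case False
        then have "x \<noteq> y" using x by auto
        define b where "b = \<bar>W w x' - W w y'\<bar>"
        define g where "g = \<bar>W w x - W w y\<bar>"
        define e where "e = \<bar>F i (W w x') - F i (W w y')\<bar>"
        define a where "a = \<bar>F i (W w x) - F i (W w y)\<bar>"
        define Y where "Y = exp (\<Sum>k<length w. C * (c ^ k * \<bar>x - y\<bar>) powr \<beta>)"
        define X where "X = exp (C * (c ^ length w * \<bar>x - y\<bar>) powr \<beta>)"
        have bg: "b > 0" "g > 0"
          using False \<open>x \<noteq> y\<close> injD[OF W_inj[OF w(1)]] by (auto simp: b_def g_def)
        have "a * b \<le> exp (C * g powr \<beta>) * e * g"
          unfolding a_def b_def e_def g_def
          using w W_K[OF w(1) x(1)] W_K[OF w(1) x(2)] W_seg[OF w(1) x(3)] W_seg[OF w(1) x(4)]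
          by (intro dist1) auto
        also have "exp (C * g powr \<beta>) \<le> X"
          unfolding X_def g_def using W_contr[OF w(1), of x y] C0 \<beta>
          by (auto intro!: mult_left_mono powr_mono2)
        finally have 1: "a * b \<le> X * e * g" using bg by (simp add: e_def mult_right_mono)
        have 2: "g * \<bar>x' - y'\<bar> \<le> Y * b * \<bar>x - y\<bar>"
          using Cons.IH unfolding g_def b_def Y_def by simp
        \<comment> \<open>The two ratio bounds are multiplied; the intermediate lengths
          \<open>b\<close> and \<open>g\<close>, positive by injectivity, then cancel.\<close>
        have "(a * b) * (g * \<bar>x' - y'\<bar>) \<le> (X * e * g) * (Y * b * \<bar>x - y\<bar>)"
          using bg by (intro mult_mono[OF 1 2]) (auto simp: X_def e_def)
        then have "(a * \<bar>x' - y'\<bar>) * (b * g) \<le> (X * Y * e * \<bar>x - y\<bar>) * (b * g)"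
          by (simp add: algebra_simps)
        then have "a * \<bar>x' - y'\<bar> \<le> X * Y * e * \<bar>x - y\<bar>"
          using bg by (simp only: mult_le_cancel_right_pos mult_pos_pos)
        moreover have "X * Y = exp (\<Sum>k<length (i # w). C * (c ^ k * \<bar>x - y\<bar>) powr \<beta>)"
          by (simp add: X_def Y_def exp_add)
        ultimately show ?thesis unfolding W_Cons a_def e_def by simp
      qed simp
    qed (simp add: W_Nil mult.commute)

    define l where "l = q - p"
    have l: "l > 0" using True by (simp add: l_def)
    \<comment> \<open>The exponential of the whole geometric series for the segment from
      \<open>p\<close> to \<open>q\<close>, hence a distortion bound for all words at once.\<close>
    define L where "L = exp (C * l powr \<beta> / (1 - c powr \<beta>))"
    have L: "L > 0" by (simp add: L_def)
    have cb: "c powr \<beta> < 1" "0 < c powr \<beta>"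
      using c \<beta> powr_less_mono2[of \<beta> c 1] by auto
    have W_dist': "\<bar>W w p - W w q\<bar> * \<bar>x' - y'\<bar> \<le> L * \<bar>W w x' - W w y'\<bar> * l"
      if "w \<in> lists I" and x: "x' \<in> {p..q}" "y' \<in> {p..q}" for w x' y'
    proof -
      have "(\<Sum>k<length w. C * (c ^ k * l) powr \<beta>) = (\<Sum>k<length w. C * l powr \<beta> * (c powr \<beta>) ^ k)"
        using c l by (intro sum.cong) (auto simp: powr_mult powr_power powr_realpow[symmetric] powr_powr mult_ac)
      also have "\<dots> = C * l powr \<beta> * (\<Sum>k<length w. (c powr \<beta>) ^ k)"
        by (simp add: sum_distrib_left)
      also have "\<dots> \<le> C * l powr \<beta> * (1 / (1 - c powr \<beta>))"
      proof (intro mult_left_mono)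
        have "(\<Sum>k<length w. (c powr \<beta>) ^ k) \<le> (\<Sum>k. (c powr \<beta>) ^ k)"
          using cb by (intro sum_le_suminf summable_geometric) auto
        also have "\<dots> = 1 / (1 - c powr \<beta>)" using cb by (intro suminf_geometric) auto
        finally show "(\<Sum>k<length w. (c powr \<beta>) ^ k) \<le> 1 / (1 - c powr \<beta>)" .
      qed (use C0 in auto)
      finally have s: "exp (\<Sum>k<length w. C * (c ^ k * l) powr \<beta>) \<le> L" by (simp add: L_def)
      have "\<bar>W w p - W w q\<bar> * \<bar>x' - y'\<bar>
        \<le> exp (\<Sum>k<length w. C * (c ^ k * \<bar>p - q\<bar>) powr \<beta>) * \<bar>W w x' - W w y'\<bar> * \<bar>p - q\<bar>"
        using that True by (intro W_dist) (auto simp: closed_segment_eq_real_ivl)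
      also have "\<bar>p - q\<bar> = l" using True by (simp add: l_def)
      also have "exp (\<Sum>k<length w. C * (c ^ k * l) powr \<beta>) * \<bar>W w x' - W w y'\<bar> * l \<le> L * \<bar>W w x' - W w y'\<bar> * l"
        using s l by (intro mult_right_mono) auto
      finally show ?thesis .
    qed

    \<comment> \<open>Disjoint pieces and transported gaps\<close>
    have F_own: "x \<in> F i ` E" if i: "i \<in> I" and x: "x \<in> E" "x \<in> F i ` {p<..<q}" for i x
    proof -
      obtain j e where j: "j \<in> I" "e \<in> E" "x = F j e" using x(1) E_eq by blast
      have hull: "open_segment (F k p) (F k q) \<subseteq> interior (convex hull (F k ` E))" for k
      proof (rule interior_maximal)
        have "closed_segment (F k p) (F k q) \<subseteq> convex hull (F k ` E)"
          using pq by (intro closed_segment_subset_convex_hull hull_inc) auto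
        then show "open_segment (F k p) (F k q) \<subseteq> convex hull (F k ` E)"
          using segment_open_subset_closed by blast
      qed (simp add: open_segment_eq_real_ivl)
      have "j = i"
      proof (rule ccontr)
        assume "j \<noteq> i"
        obtain z where z: "z \<in> {p<..<q}" "x = F i z" using x(2) by blast
        have "x \<in> closed_segment (F i p) (F i q)"
          unfolding z(2) using z(1) by (intro seg i) (auto simp: closed_segment_eq_real_ivl)
        moreover have "x \<noteq> F i p" "x \<noteq> F i q" using z injD[OF inj[OF i]] by auto
        ultimately have x1: "x \<in> open_segment (F i p) (F i q)" by (simp add: open_segment_def)
        have "F j p \<noteq> F j q" using True injD[OF inj[OF j(1)]] by fastforce
        moreover have "x \<in> closed_segment (F j p) (F j q)"
          unfolding j(3) using j(2) EK by (intro seg j) (auto simp: closed_segment_eq_real_ivl)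
        \<comment> \<open>\<open>x\<close> may be an endpoint of the hull of piece \<open>j\<close>.
          Being in the closure suffices, since the open segment of piece \<open>i\<close> is a
          neighbourhood of \<open>x\<close> and so meets the open segment of piece
          \<open>j\<close>.\<close>
        ultimately have "x \<in> closure (open_segment (F j p) (F j q))" by simp
        moreover have "open (open_segment (F i p) (F i q))" by (simp add: open_segment_eq_real_ivl)
        ultimately have "open_segment (F i p) (F i q) \<inter> open_segment (F j p) (F j q) \<noteq> {}"
          using x1 open_Int_closure_eq_empty[of "open_segment (F i p) (F i q)" "open_segment (F j p) (F j q)"]
          by blast
        then show False using hull[of i] hull[of j] disj[of i j] \<open>j \<noteq> i\<close> i j(1) unfolding I_def by blast
      qed
      then show ?thesis using j by auto
    qed
    have W_own: "x \<in> W w ` E" if "w \<in> lists I" "x \<in> E" "x \<in> W w ` {p<..<q}" for w x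
      using that
    proof (induction w arbitrary: x)
      case (Cons i w)
      then have i: "i \<in> I" "w \<in> lists I" by auto
      obtain z where z: "z \<in> {p<..<q}" "x = F i (W w z)" using Cons.prems(2) by (auto simp: W_Cons)
      have "W w z \<in> {p..q}" using z(1) i by (intro W_K) auto
      \<comment> \<open>\<open>F_own\<close> applies only off the endpoints. Injectivity keeps
        \<open>W w z\<close> strictly inside its own cylinder hull, and that hull lies in
        \<open>{p..q}\<close>.\<close>
      moreover have "W w z \<noteq> p \<and> W w z \<noteq> q"
      proof (intro conjI notI)
        have "W w z \<in> open_segment (W w p) (W w q)"
          using W_seg[OF i(2), of z p q] z(1) injD[OF W_inj[OF i(2)]]
          by (auto simp: open_segment_def closed_segment_eq_real_ivl)
        moreover have "W w p \<in> {p..q}" "W w q \<in> {p..q}" using i W_K[of w p] W_K[of w q] True by auto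
        ultimately show "W w z = p \<Longrightarrow> False" "W w z = q \<Longrightarrow> False"
          by (auto simp: open_segment_eq_real_ivl split: if_splits)
      qed
      ultimately have "x \<in> F i ` {p<..<q}" using z(2) by auto
      then obtain e where e: "e \<in> E" "x = F i e" using F_own[OF i(1) Cons.prems(1)] by auto
      then have "e = W w z" using z(2) injD[OF inj[OF i(1)]] by auto
      then have "e \<in> W w ` E" using Cons.IH[OF e(1)] i z(1) by auto
      then show ?case using e by (auto simp: W_Cons)
    qed (simp add: W_Nil)

    \<comment> \<open>Here \<open>nint\<close> enters: a closed \<open>E\<close> different from
      \<open>{p..q}\<close> misses a small interval strictly inside. If \<open>E\<close> were an
      interval, there would be no gaps and \<open>f_map\<close> would be the identity; the Cantor
      measure on \<open>{0..1}\<close>, whose transform does not decay, shows that the conclusion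
      can then fail.\<close>
    obtain u v where uv: "p < u" "u < v" "v < q" "{u<..<v} \<inter> E = {}"
    proof -
      have "E \<noteq> {p..q}" using nint True by blast
      then obtain z where z: "z \<in> {p..q}" "z \<notin> E" using EK by blast
      then have "z \<in> {p<..<q} \<inter> - E" using pq by (auto simp: less_le)
      moreover have "open ({p<..<q} \<inter> - E)" using \<open>closed E\<close> by (intro open_Int) auto
      ultimately obtain e where e: "e > 0" "cball z e \<subseteq> {p<..<q} \<inter> - E"
        using open_contains_cball by blast
      then have "z - e \<in> {p<..<q}" "z + e \<in> {p<..<q}" by (auto simp: subset_iff dist_real_def)
      moreover have "{z - e<..<z + e} \<subseteq> cball z e" by (auto simp: dist_real_def)
      ultimately show ?thesis using e by (intro that[of "z - e" "z + e"]) auto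
    qed
    have W_gap: "open_segment (W w u) (W w v) \<inter> E = {}" if "w \<in> lists I" for w
    proof (rule ccontr)
      assume "open_segment (W w u) (W w v) \<inter> E \<noteq> {}"
      then obtain y where y: "y \<in> open_segment (W w u) (W w v)" "y \<in> E" by auto
      have "connected (W w ` {u..v})"
        using W_cont[OF that] by (intro connected_continuous_image) (auto intro: continuous_on_subset)
      then have "closed_segment (W w u) (W w v) \<subseteq> W w ` {u..v}"
        using uv by (intro closed_segment_subset) (auto simp: connected_convex_1[symmetric])
      then obtain x where x: "x \<in> {u..v}" "y = W w x"
        using y(1) by (auto simp: open_segment_def)
      have "x \<noteq> u" "x \<noteq> v" using x y(1) by (auto simp: open_segment_def)
      then have xx: "x \<in> {u<..<v}" "x \<in> {p<..<q}" using x uv by auto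
      \<comment> \<open>By \<open>W_own\<close> the point \<open>y\<close> has a preimage in
        \<open>E\<close>; by injectivity it is \<open>x\<close>, which lies in the fixed
        gap.\<close>
      then have "y \<in> W w ` E" using W_own[OF that y(2)] x(2) by auto
      then have "x \<in> E" using x(2) injD[OF W_inj[OF that]] by auto
      then show False using xx uv by auto
    qed

    \<comment> \<open>Cylinders of prescribed length\<close>
    have "I \<noteq> {}" using \<open>E \<noteq> {}\<close> E_eq by auto
    \<comment> \<open>A lower bound for the ratio of a child cylinder to its parent: the ratio
      \<open>\<bar>F i p - F i q\<bar> / l\<close> at the first level persists at all levels up to
      the distortion \<open>L\<close>.\<close>
    define \<eta> where "\<eta> = Min ((\<lambda>i. \<bar>F i p - F i q\<bar> / (L * l)) ` I)"
    have "0 < \<bar>F i p - F i q\<bar> / (L * l)" if "i \<in> I" for i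
      using injD[OF inj[OF that], of p q] True L l by (intro divide_pos_pos mult_pos_pos) auto
    then have \<eta>: "\<eta> > 0"
      unfolding \<eta>_def using \<open>I \<noteq> {}\<close> by (subst Min_gr_iff) (auto simp: I_def)
    have \<eta>_le: "\<eta> \<le> \<bar>F i p - F i q\<bar> / (L * l)" if "i \<in> I" for i
      unfolding \<eta>_def using that by (intro Min_le) (auto simp: I_def)
    have W_child: "\<eta> * \<bar>W w p - W w q\<bar> \<le> \<bar>W (w @ [i]) p - W (w @ [i]) q\<bar>" if "w \<in> lists I" "i \<in> I" for w i
    proof -
      have "\<bar>W w p - W w q\<bar> * \<bar>F i p - F i q\<bar> \<le> L * \<bar>W w (F i p) - W w (F i q)\<bar> * l"
        using that True by (intro W_dist' FK) auto
      then have "\<bar>W w p - W w q\<bar> * (\<bar>F i p - F i q\<bar> / (L * l)) \<le> \<bar>W (w @ [i]) p - W (w @ [i]) q\<bar>"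
        unfolding W_snoc using L l by (simp add: field_simps)
      then show ?thesis using mult_left_mono[OF \<eta>_le[OF that(2)], of "\<bar>W w p - W w q\<bar>"]
        by (simp add: mult.commute)
    qed

    have cyl: "\<exists>w\<in>lists I. e \<in> W w ` E \<and> \<eta> * r \<le> \<bar>W w p - W w q\<bar> \<and> \<bar>W w p - W w q\<bar> < r"
      if e: "e \<in> E" and r: "0 < r" "r \<le> l" for e r
    proof -
      \<comment> \<open>The greatest \<open>n\<close> with \<open>Q n\<close> is the last level with
        a cylinder through \<open>e\<close> of length at least \<open>r\<close>. One further letter
        makes the length drop below \<open>r\<close>, but by no more than the factor
        \<open>\<eta>\<close>.\<close>
      define Q where "Q n \<longleftrightarrow> (\<exists>w\<in>lists I. length w = n \<and> e \<in> W w ` E \<and> r \<le> \<bar>W w p - W w q\<bar>)" for n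
      have Q0: "Q 0" unfolding Q_def using e r by (auto simp: W_Nil l_def)
      obtain n0 where n0: "c ^ n0 * l < r"
        using real_arch_pow_inv[of "r / l" c] c l r by (auto simp: field_simps)
      have "n \<le> n0" if "Q n" for n
      proof (rule ccontr)
        assume "\<not> n \<le> n0"
        obtain w where w: "w \<in> lists I" "length w = n" "r \<le> \<bar>W w p - W w q\<bar>" using \<open>Q n\<close> by (auto simp: Q_def)
        have "\<bar>W w p - W w q\<bar> \<le> c ^ n * l" using W_contr[OF w(1), of p q] w(2) True by (simp add: l_def)
        also have "\<dots> \<le> c ^ n0 * l" using \<open>\<not> n \<le> n0\<close> c l by (intro mult_right_mono power_decreasing) auto
        finally show False using n0 w(3) by simp
      qed
      then obtain n where n: "Q n" "\<And>n'. Q n' \<Longrightarrow> n' \<le> n"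
        using Q0 GreatestI_nat[of Q 0 n0] Greatest_le_nat[of Q _ n0] by blast
      then obtain w where w: "w \<in> lists I" "length w = n" "e \<in> W w ` E" "r \<le> \<bar>W w p - W w q\<bar>"
        by (auto simp: Q_def)
      then obtain e' where e': "e' \<in> E" "e = W w e'" by auto
      then obtain i e'' where i: "i \<in> I" "e'' \<in> E" "e' = F i e''" using E_eq by blast
      have w': "w @ [i] \<in> lists I" "e \<in> W (w @ [i]) ` E"
        using w i e' by (auto simp: W_snoc)
      have "\<not> Q (Suc n)" using n(2) by fastforce
      then have "\<bar>W (w @ [i]) p - W (w @ [i]) q\<bar> < r"
        using w' w(2) unfolding Q_def by (meson length_append_singleton not_le)
      moreover have "\<eta> * r \<le> \<bar>W (w @ [i]) p - W (w @ [i]) q\<bar>"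
        using W_child[OF w(1) i(1)] mult_left_mono[OF w(4), of \<eta>] \<eta> by linarith
      ultimately show ?thesis using w' by blast
    qed

    \<comment> \<open>\<open>1/3\<close> serves the case of an empty middle third. Otherwise the
      cylinder has length at least \<open>\<eta> * r\<close> with \<open>r = (b - a) / 3\<close>,
      and the image of the fixed gap takes at least the share \<open>(v - u) / (L * l)\<close> of
      it.\<close>
    define \<kappa> where "\<kappa> = min (1/3) (\<eta> * (v - u) / (3 * L * l))"
    have \<kappa>: "\<kappa> > 0" using \<eta> uv L l by (auto simp: \<kappa>_def)
    have "\<exists>U\<in>gaps E. U \<subseteq> {a<..<b} \<and> \<kappa> * (b - a) \<le> len U" if ab: "a \<in> E" "b \<in> E" "a < b" for a b
    proof -
      define r where "r = (b - a) / 3"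
      have r: "0 < r" "r \<le> l" using ab subsetD[OF EK ab(1)] subsetD[OF EK ab(2)] by (auto simp: r_def l_def)
      obtain x y where xy: "x < y" "{x<..<y} \<subseteq> {a<..<b}" "{x<..<y} \<inter> E = {}" "\<kappa> * (b - a) \<le> y - x"
      proof (cases "{a + r<..<b - r} \<inter> E = {}")
        case True
        have "\<kappa> * (b - a) \<le> 1/3 * (b - a)" using ab by (intro mult_right_mono) (auto simp: \<kappa>_def)
        moreover have "b = a + 3 * r" by (simp add: r_def field_simps)
        ultimately show ?thesis using True r by (intro that[of "a + r" "b - r"]) auto
      next
        case False
        then obtain e where e: "e \<in> E" "a + r < e" "e < b - r" by auto
        obtain w where w: "w \<in> lists I" "e \<in> W w ` E" "\<eta> * r \<le> \<bar>W w p - W w q\<bar>" "\<bar>W w p - W w q\<bar> < r"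
          using cyl[OF e(1) r] by blast
        have in_cyl: "W w x \<in> closed_segment (W w p) (W w q)" if "x \<in> {p..q}" for x
          using that by (intro W_seg w) (auto simp: closed_segment_eq_real_ivl)
        have "e \<in> closed_segment (W w p) (W w q)" using w(2) in_cyl EK by blast
        moreover have "W w u \<in> closed_segment (W w p) (W w q)" "W w v \<in> closed_segment (W w p) (W w q)"
          using in_cyl uv by auto
        ultimately have near: "W w u \<in> {a<..<b}" "W w v \<in> {a<..<b}"
          using w(4) e by (auto simp: closed_segment_eq_real_ivl split: if_splits)
        have "W w u \<noteq> W w v" using uv injD[OF W_inj[OF w(1)], of u v] by auto
        have "\<kappa> * (b - a) \<le> \<eta> * (v - u) / (3 * L * l) * (b - a)"
          using ab by (intro mult_right_mono) (auto simp: \<kappa>_def)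
        also have "\<dots> = \<eta> * r * (v - u) / (L * l)" by (simp add: r_def field_simps)
        also have "\<dots> \<le> \<bar>W w p - W w q\<bar> * (v - u) / (L * l)"
          using w(3) uv L l by (intro divide_right_mono mult_right_mono) auto
        also have "\<dots> \<le> \<bar>W w u - W w v\<bar>"
          using W_dist'[OF w(1), of u v] uv L l by (simp add: field_simps)
        finally have k: "\<kappa> * (b - a) \<le> \<bar>W w u - W w v\<bar>" .
        show ?thesis
        proof (rule that[of "min (W w u) (W w v)" "max (W w u) (W w v)"])
          have "{min (W w u) (W w v)<..<max (W w u) (W w v)} = open_segment (W w u) (W w v)"
            by (auto simp: open_segment_eq_real_ivl)
          then show "{min (W w u) (W w v)<..<max (W w u) (W w v)} \<inter> E = {}" using W_gap[OF w(1)] by simp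
        qed (use near k \<open>W w u \<noteq> W w v\<close> in auto)
      qed
      obtain U where "U \<in> gaps E" "U \<subseteq> {a<..<b}" "y - x \<le> len U"
        using gap_containing[OF ab(1,2) \<open>closed E\<close> xy(1,2,3)] by blast
      then show ?thesis using xy(4) by (intro bexI[of _ U]) auto
    qed
    then show ?thesis using \<kappa> by (intro exI[of _ \<kappa>] conjI ballI impI)
  qed
qed

section \<open>Separating points by gaps\<close>

text \<open>In the application \<open>S\<close> consists of the gaps of length at least
  \<open>\<rho>\<close>, \<open>b u x\<close> says that the gap \<open>u\<close> lies to the left of
  \<open>x\<close>, and \<open>r\<close> is \<open>\<rho> / \<kappa>\<close>.\<close>

locale separated_measure = prob_space M for M :: "real measure" +
  fixes S :: "'u set" and b :: "'u \<Rightarrow> real \<Rightarrow> bool" and r B :: real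
  assumes sets_M: "sets M = sets (restrict_space borel (space M))"
    and finite_S: "finite S"
    and b_mono: "\<And>u x y. u \<in> S \<Longrightarrow> x \<le> y \<Longrightarrow> b u x \<Longrightarrow> b u y"
    and b_measurable: "\<And>u. u \<in> S \<Longrightarrow> Measurable.pred M (b u)"
    and separated: "\<And>x y. x \<in> space M \<Longrightarrow> y \<in> space M \<Longrightarrow> x \<le> y \<Longrightarrow> (\<And>u. u \<in> S \<Longrightarrow> b u x \<longleftrightarrow> b u y) \<Longrightarrow> y - x \<le> r"
    and interval_measure: "\<And>p q. p \<le> q \<Longrightarrow> q - p \<le> r \<Longrightarrow> measure M ({p..q} \<inter> space M) \<le> B"
begin

lemma Int_space_in_sets: "A \<in> sets borel \<Longrightarrow> A \<inter> space M \<in> sets M"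
  by (subst sets_M) (auto simp: sets_restrict_space)

definition sep :: "real \<Rightarrow> real \<Rightarrow> real" where
  "sep x y = (\<Prod>u\<in>S. if b u x \<longleftrightarrow> b u y then 1 else 1/2)"

text \<open>The later bound for the expected product of the phases at the points \<open>x i\<close>,
  one factor per gap. For two distinct indices it reduces to \<open>sep\<close>.\<close>

definition par :: "nat set \<Rightarrow> (nat \<Rightarrow> real) \<Rightarrow> real" where
  "par I x = (\<Prod>u\<in>S. if even (\<Sum>i\<in>I. of_bool (b u (x i)) :: nat) then 1 else 1/2)"

lemma sep_pos: "sep x y > 0"
  by (auto simp: sep_def intro!: prod_pos)

lemma sep_commute: "sep x y = sep y x"
  unfolding sep_def by (intro prod.cong) auto

lemma par_pos: "par I x > 0"
  by (auto simp: par_def intro!: prod_pos)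

lemma sep_power: "\<exists>n. sep x y = (1/2) ^ n"
proof -
  have "sep x y = (\<Prod>u\<in>S. (1/2) ^ (if b u x \<longleftrightarrow> b u y then 0 else 1))"
    unfolding sep_def by (intro prod.cong) simp_all
  also have "\<dots> = (1/2) ^ (\<Sum>u\<in>S. if b u x \<longleftrightarrow> b u y then 0 else 1)"
    by (rule power_sum[symmetric])
  finally show ?thesis by blast
qed

text \<open>Since \<open>b u\<close> switches at most once along the line, a \<open>u\<close> that
  separates \<open>x\<close> from \<open>z\<close> separates exactly one of the pairs
  \<open>x, y\<close> and \<open>y, z\<close>.\<close>

lemma sep_mult:
  assumes "x \<le> y" "y \<le> z"
  shows "sep x z = sep x y * sep y z"
  unfolding sep_def prod.distrib[symmetric]
proof (intro prod.cong refl)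
  fix u assume u: "u \<in> S"
  have "b u x \<Longrightarrow> b u y" "b u y \<Longrightarrow> b u z"
    by (fact b_mono[OF u assms(1)], fact b_mono[OF u assms(2)])
  then show "(if b u x = b u z then 1 else 1 / 2) =
      (if b u x = b u y then 1 else 1 / 2) * (if b u y = b u z then 1 else 1 / (2::real))"
    by (cases "b u x"; cases "b u y"; cases "b u z") simp_all
qed

lemma sep_eq_1:
  assumes "sep x y = 1" "u \<in> S"
  shows "b u x \<longleftrightarrow> b u y"
proof (rule ccontr)
  assume ne: "\<not> ?thesis"
  have "sep x y = (if b u x \<longleftrightarrow> b u y then 1 else 1/2) * (\<Prod>u\<in>S - {u}. if b u x \<longleftrightarrow> b u y then 1 else 1/2)"
    unfolding sep_def by (rule prod.remove) (use assms finite_S in auto)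
  moreover have "(\<Prod>u\<in>S - {u}. if b u x \<longleftrightarrow> b u y then 1 else 1/2 :: real) \<le> 1"
    by (rule prod_le_1) auto
  ultimately show False using assms ne by simp
qed

lemma sep_measurable [measurable]:
  assumes [measurable]: "f \<in> N \<rightarrow>\<^sub>M M" "g \<in> N \<rightarrow>\<^sub>M M"
  shows "(\<lambda>x. sep (f x) (g x)) \<in> borel_measurable N"
proof -
  have [measurable]: "Measurable.pred N (\<lambda>x. b u (h x))" if "u \<in> S" "h \<in> N \<rightarrow>\<^sub>M M" for u h
    using measurable_compose[OF that(2) b_measurable[OF that(1)]] by simp
  show ?thesis unfolding sep_def by measurable
qed

lemma par_measurable [measurable]:
  assumes "finite I" "I \<subseteq> J"
  shows "par I \<in> borel_measurable (PiM J (\<lambda>_. M))"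
proof -
  have [measurable]: "Measurable.pred (PiM J (\<lambda>_. M)) (\<lambda>x. b u (x i))" if "u \<in> S" "i \<in> I" for u i
    using measurable_compose[OF measurable_component_singleton[of i J "\<lambda>_. M"] b_measurable[OF that(1)]] that(2) assms by auto
  show ?thesis unfolding par_def by measurable
qed

text \<open>Unseparated points are pairwise within \<open>r\<close>, so \<open>Y\<close> lies in the
  interval from \<open>Inf Y\<close> to \<open>Sup Y\<close>, to which
  \<open>interval_measure\<close> applies. The empty set is included because it yields
  \<open>0 \<le> B\<close>.\<close>

lemma level_set_measure:
  assumes "\<And>x y. x \<in> Y \<Longrightarrow> y \<in> Y \<Longrightarrow> x \<le> y \<Longrightarrow> sep x y = 1" "Y \<subseteq> space M"
  shows "measure M Y \<le> B"
proof (cases "Y = {}")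
  case True
  have "0 \<le> measure M ({0..0} \<inter> space M)" by simp
  show ?thesis
  proof (cases "r \<ge> 0")
    case True
    then have "measure M ({0..0} \<inter> space M) \<le> B" by (intro interval_measure) auto
    with \<open>0 \<le> measure M ({0..0} \<inter> space M)\<close> have "0 \<le> B" by linarith
    then show ?thesis using \<open>Y = {}\<close> by simp
  next
    case False
    then show ?thesis using separated not_empty by fastforce
  qed
next
  case False
  then obtain y0 where y0: "y0 \<in> Y" by auto
  have close: "y - x \<le> r" if "x \<in> Y" "y \<in> Y" for x y
  proof (cases "x \<le> y")
    case True
    then show ?thesis using separated[of x y] sep_eq_1[OF assms(1)[OF that]] that assms(2) by blast
  next
    case f: False
    have "x - x \<le> r" using separated[of x x] that assms(2) by auto
    then show ?thesis using f by simp
  qed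
  have bdd: "bdd_below Y" "bdd_above Y"
    using close[OF y0] close[OF _ y0]
    by (auto intro!: bdd_belowI[of Y "y0 - r"] bdd_aboveI[of Y "y0 + r"] simp: diff_le_eq add.commute)
  have sub: "Y \<subseteq> {Inf Y..Sup Y} \<inter> space M"
    using bdd assms(2) by (auto intro: cInf_lower cSup_upper)
  have "Sup Y \<le> Inf Y + r"
  proof (rule cSup_least[OF False])
    fix y assume "y \<in> Y"
    then have "y - r \<le> Inf Y" using close False by (intro cInf_greatest) (auto simp: algebra_simps)
    then show "y \<le> Inf Y + r" by simp
  qed
  moreover have "Inf Y \<le> Sup Y" using sub y0 by fastforce
  ultimately have "measure M ({Inf Y..Sup Y} \<inter> space M) \<le> B" by (intro interval_measure) auto
  moreover have "{Inf Y..Sup Y} \<inter> space M \<in> sets M"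
    by (rule Int_space_in_sets) simp
  then have "measure M Y \<le> measure M ({Inf Y..Sup Y} \<inter> space M)"
    using sub by (intro finite_measure_mono) auto
  ultimately show ?thesis by linarith
qed

text \<open>The level sets \<open>Y n\<close> collect the points with exactly \<open>n\<close> gaps
  between them and \<open>x\<close>. On either side of \<open>x\<close>, \<open>sep_mult\<close>
  shows that such points are not separated from each other, so \<open>Y n\<close> has measure at
  most \<open>2 * B\<close>; the weights \<open>(1/2) ^ n\<close> sum to 2.\<close>

lemma nn_integral_sep:
  assumes x: "x \<in> space M"
  shows "(\<integral>\<^sup>+y. ennreal (sep x y) \<partial>M) \<le> ennreal (4 * B)"
proof -
  define Y where "Y n = {y \<in> space M. sep x y = (1/2) ^ n}" for n :: nat
  have [measurable]: "Y n \<in> sets M" for n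
    unfolding Y_def using x by measurable
  have B0: "0 \<le> B" using level_set_measure[of "{}"] by simp
  have Y: "emeasure M (Y n) \<le> ennreal (2 * B)" for n
  proof -
    have eq1: "sep y z = 1" if "y \<in> Y n" "z \<in> Y n" "x \<le> y \<and> y \<le> z \<or> y \<le> z \<and> z \<le> x" for y z
      using that(3)
    proof
      assume "x \<le> y \<and> y \<le> z"
      then have "sep x z = sep x y * sep y z" using sep_mult by blast
      then show ?thesis using that by (simp add: Y_def)
    next
      assume "y \<le> z \<and> z \<le> x"
      then have "sep y x = sep y z * sep z x" using sep_mult by blast
      then show ?thesis using that by (simp add: Y_def sep_commute[of _ x])
    qed
    have "measure M (Y n \<inter> {x..}) \<le> B" "measure M (Y n \<inter> {..x}) \<le> B"
      by (intro level_set_measure eq1; auto simp: Y_def)+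
    moreover have "measure M (Y n) \<le> measure M (Y n \<inter> {x..}) + measure M (Y n \<inter> {..x})"
    proof -
      have "Y n \<inter> {x..} \<in> sets M" "Y n \<inter> {..x} \<in> sets M"
        using sets.Int[OF \<open>Y n \<in> sets M\<close> Int_space_in_sets[of "{x..}"]]
          sets.Int[OF \<open>Y n \<in> sets M\<close> Int_space_in_sets[of "{..x}"]] sets.sets_into_space[OF \<open>Y n \<in> sets M\<close>]
        by (auto simp: Int_assoc[symmetric] Int_absorb2 le_infI1)
      then have "measure M (Y n \<inter> {x..} \<union> Y n \<inter> {..x}) \<le> measure M (Y n \<inter> {x..}) + measure M (Y n \<inter> {..x})"
        by (rule measure_Un_le)
      also have "Y n \<inter> {x..} \<union> Y n \<inter> {..x} = Y n" by auto
      finally show ?thesis .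
    qed
    ultimately show ?thesis unfolding emeasure_eq_measure by (intro ennreal_leI) linarith
  qed
  have "(\<integral>\<^sup>+y. ennreal (sep x y) \<partial>M) \<le> (\<integral>\<^sup>+y. (\<Sum>n. ennreal ((1/2) ^ n) * indicator (Y n) y) \<partial>M)"
  proof (intro nn_integral_mono)
    fix y assume "y \<in> space M"
    moreover obtain n where n: "sep x y = (1/2) ^ n" using sep_power by blast
    ultimately have "ennreal (sep x y) = (\<Sum>k\<in>{n}. ennreal ((1/2) ^ k) * indicator (Y k) y)"
      by (simp add: Y_def)
    also have "\<dots> \<le> (\<Sum>n. ennreal ((1/2) ^ n) * indicator (Y n) y)"
      by (intro sum_le_suminf) auto
    finally show "ennreal (sep x y) \<le> (\<Sum>n. ennreal ((1/2) ^ n) * indicator (Y n) y)" .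
  qed
  also have "\<dots> = (\<Sum>n. ennreal ((1/2) ^ n) * emeasure M (Y n))"
    by (subst nn_integral_suminf) (auto simp: nn_integral_cmult_indicator)
  also have "\<dots> \<le> (\<Sum>n. ennreal ((1/2) ^ n) * ennreal (2 * B))"
    using Y by (intro suminf_le mult_left_mono) auto
  also have "\<dots> = (\<Sum>n. ennreal ((1/2) ^ n * (2 * B)))"
    using B0 by (intro suminf_cong ennreal_mult[symmetric]) auto
  also have "\<dots> = ennreal (\<Sum>n. (1/2) ^ n * (2 * B))"
    using B0 by (intro suminf_ennreal2 summable_mult2 summable_geometric) auto
  also have "(\<Sum>n. (1/2) ^ n * (2 * B)) = 4 * B"
    by (subst suminf_mult2[symmetric]) (auto simp: suminf_geometric intro: summable_geometric)
  finally show ?thesis .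
qed

text \<open>The pair consists of the two smallest coordinates: a gap between them has all other
  coordinates to its right.\<close>
lemma par_remove_pair:
  assumes "finite I" "even (card I)" "I \<noteq> {}"
  shows "\<exists>i\<in>I. \<exists>j\<in>I - {i}. par I x = sep (x i) (x j) * par (I - {i, j}) x"
proof -
  obtain i where i: "i \<in> I" "\<And>k. k \<in> I \<Longrightarrow> x i \<le> x k"
    using assms ex_min_if_finite[of "x ` I"] by (metis (mono_tags, lifting) arg_min_if_finite(1) arg_min_least)
  have "I - {i} \<noteq> {}"
  proof
    assume "I - {i} = {}"
    then have "I = {i}" using i(1) by auto
    then show False using assms by simp
  qed
  then obtain j where j: "j \<in> I - {i}" "\<And>k. k \<in> I - {i} \<Longrightarrow> x j \<le> x k"
    using assms by (metis (mono_tags, lifting) arg_min_if_finite(1) arg_min_least finite_Diff)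
  define K where "K = I - {i, j}"
  have I: "I = insert i (insert j K)" "i \<notin> insert j K" "j \<notin> K" "finite K"
    using i j assms by (auto simp: K_def)
  have "even (card K)" using assms(2) I(2-4) unfolding I(1) by simp
  have "par I x = sep (x i) (x j) * par K x"
    unfolding par_def sep_def prod.distrib[symmetric]
  proof (intro prod.cong refl)
    fix u assume u: "u \<in> S"
    have "b u (x k)" if "b u (x j)" "k \<in> K" for k
      using b_mono[OF u j(2)[of k] that(1)] that(2) by (auto simp: K_def)
    then have "even (\<Sum>k\<in>K. of_bool (b u (x k)) :: nat)" if "b u (x j)"
      using that \<open>even (card K)\<close> by simp
    moreover have "(\<Sum>k\<in>I. of_bool (b u (x k)) :: nat) =
        of_bool (b u (x i)) + (of_bool (b u (x j)) + (\<Sum>k\<in>K. of_bool (b u (x k))))"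
      unfolding I(1) using I(2-4) by simp
    moreover have "b u (x i) \<Longrightarrow> b u (x j)" using b_mono[OF u i(2)[of j]] j(1) by auto
    ultimately show "(if even (\<Sum>i\<in>I. of_bool (b u (x i)) :: nat) then 1 else 1 / 2) =
         (if b u (x i) = b u (x j) then 1 else 1 / 2) *
         (if even (\<Sum>i\<in>K. of_bool (b u (x i)) :: nat) then 1 else 1 / (2::real))"
      by (cases "b u (x i)"; cases "b u (x j)") simp_all
  qed
  then show ?thesis using i(1) j(1) unfolding K_def by blast
qed

text \<open>Which pair is removed depends on \<open>x\<close>, so the integrand is bounded by the
  sum over all \<open>n * (n - 1)\<close> ordered pairs; these numbers multiply up to the factorial.
  For a fixed pair, integrating over coordinate \<open>i\<close> costs \<open>4 * B\<close>, after
  which coordinate \<open>j\<close> no longer occurs and integrates to 1.\<close>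

lemma nn_integral_par:
  assumes "finite I" "even (card I)"
  shows "(\<integral>\<^sup>+x. ennreal (par I x) \<partial>PiM I (\<lambda>_. M)) \<le> ennreal (fact (card I) * (4 * B) ^ (card I div 2))"
  using assms
proof (induction "card I" arbitrary: I rule: less_induct)
  case (less I)
  have M1: "emeasure M (space M) = 1" by (rule emeasure_space_1)
  interpret product_prob_space "\<lambda>_. M" I
    by unfold_locales
  have B0: "0 \<le> B" using level_set_measure[of "{}"] by simp
  show ?case
  proof (cases "I = {}")
    case True
    have "par {} x = 1" for x by (simp add: par_def)
    then show ?thesis using P.emeasure_space_1 True by simp
  next
    case False
    define n where "n = card I"
    define Q where "Q = (SIGMA i:I. I - {i})"
    define X where "X = ennreal (fact (n - 2) * (4 * B) ^ ((n - 2) div 2))"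
    have "finite Q" using less by (simp add: Q_def)
    have n: "n \<ge> 2" "even n"
    proof -
      have "n \<noteq> 0" "n \<noteq> 1" using less(2,3) False by (auto simp: n_def)
      then show "n \<ge> 2" by linarith
      show "even n" using less(3) by (simp add: n_def)
    qed
    have pair: "(\<integral>\<^sup>+x. ennreal (sep (x i) (x j) * par (I - {i, j}) x) \<partial>PiM I (\<lambda>_. M)) \<le> ennreal (4 * B) * X"
      if "i \<in> I" "j \<in> I - {i}" for i j
    proof -
      define K where "K = I - {i, j}"
      have I: "I = insert i (insert j K)" "i \<notin> insert j K" "j \<notin> K" "finite K"
        using that less by (auto simp: K_def)
      have cK: "card K = n - 2" unfolding n_def using I(2-4) by (subst I(1)) simp
      have meas: "(\<lambda>x. sep (x i) (x j) * par K x) \<in> borel_measurable (PiM J (\<lambda>_. M))"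
        if "i \<in> J" "j \<in> J" "K \<subseteq> J" for J
        using that I(4) by (intro borel_measurable_times sep_measurable par_measurable measurable_component_singleton)
      have par_upd: "par K (x(k := y)) = par K x" if "k \<notin> K" for x y k
        using that unfolding par_def by (intro prod.cong sum.cong arg_cong[where f="\<lambda>n. if even n then _ else _"] refl) auto
      have "(\<integral>\<^sup>+x. ennreal (sep (x i) (x j) * par K x) \<partial>PiM I (\<lambda>_. M)) =
        (\<integral>\<^sup>+x. \<integral>\<^sup>+y. ennreal (sep ((x(i := y)) i) ((x(i := y)) j) * par K (x(i := y))) \<partial>M \<partial>PiM (insert j K) (\<lambda>_. M))"
        unfolding I(1) using I(2-4) by (intro product_nn_integral_insert measurable_compose[OF _ measurable_ennreal] meas) auto
      also have "\<dots> = (\<integral>\<^sup>+x. \<integral>\<^sup>+y. ennreal (sep (x j) y) * ennreal (par K x) \<partial>M \<partial>PiM (insert j K) (\<lambda>_. M))"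
        using I(2,3) sep_pos par_pos
        by (intro nn_integral_cong) (auto simp: par_upd ennreal_mult less_imp_le sep_commute)
      also have "\<dots> \<le> (\<integral>\<^sup>+x. ennreal (4 * B) * ennreal (par K x) \<partial>PiM (insert j K) (\<lambda>_. M))"
      proof (intro nn_integral_mono)
        fix x assume "x \<in> space (PiM (insert j K) (\<lambda>_. M))"
        then have xj: "x j \<in> space M" by (auto simp: space_PiM)
        have "(\<integral>\<^sup>+y. ennreal (sep (x j) y) * ennreal (par K x) \<partial>M) = (\<integral>\<^sup>+y. ennreal (sep (x j) y) \<partial>M) * ennreal (par K x)"
          using xj by (intro nn_integral_multc) measurable
        also have "\<dots> \<le> ennreal (4 * B) * ennreal (par K x)"
          using nn_integral_sep[OF xj] by (intro mult_right_mono) auto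
        finally show "(\<integral>\<^sup>+y. ennreal (sep (x j) y) * ennreal (par K x) \<partial>M) \<le> ennreal (4 * B) * ennreal (par K x)" .
      qed
      also have "\<dots> = ennreal (4 * B) * (\<integral>\<^sup>+x. ennreal (par K x) \<partial>PiM (insert j K) (\<lambda>_. M))"
        by (intro nn_integral_cmult) (auto intro!: par_measurable I(4) measurable_compose[OF _ measurable_ennreal])
      also have "(\<integral>\<^sup>+x. ennreal (par K x) \<partial>PiM (insert j K) (\<lambda>_. M)) = (\<integral>\<^sup>+x. \<integral>\<^sup>+y. ennreal (par K (x(j := y))) \<partial>M \<partial>PiM K (\<lambda>_. M))"
        using I(3,4) by (intro product_nn_integral_insert) (auto intro!: par_measurable I(4) measurable_compose[OF _ measurable_ennreal])
      also have "\<dots> = (\<integral>\<^sup>+x. ennreal (par K x) \<partial>PiM K (\<lambda>_. M))"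
        using I(3) by (simp add: par_upd M1)
      also have "\<dots> \<le> X"
        unfolding X_def cK[symmetric] using cK n I(4) unfolding n_def
        by (intro less(1)) auto
      finally show ?thesis unfolding K_def by (simp add: mult_left_mono)
    qed
    have "(\<integral>\<^sup>+x. ennreal (par I x) \<partial>PiM I (\<lambda>_. M))
      \<le> (\<integral>\<^sup>+x. (\<Sum>(i,j)\<in>Q. ennreal (sep (x i) (x j) * par (I - {i, j}) x)) \<partial>PiM I (\<lambda>_. M))"
    proof (intro nn_integral_mono)
      fix x
      obtain i j where ij: "i \<in> I" "j \<in> I - {i}" "par I x = sep (x i) (x j) * par (I - {i, j}) x"
        using par_remove_pair[OF less(2,3) False] by blast
      have "ennreal (par I x) = (\<Sum>(i,j)\<in>{(i,j)}. ennreal (sep (x i) (x j) * par (I - {i, j}) x))"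
        using ij by simp
      also have "\<dots> \<le> (\<Sum>(i,j)\<in>Q. ennreal (sep (x i) (x j) * par (I - {i, j}) x))"
        using ij \<open>finite Q\<close> by (intro sum_mono2) (auto simp: Q_def)
      finally show "ennreal (par I x) \<le> (\<Sum>(i,j)\<in>Q. ennreal (sep (x i) (x j) * par (I - {i, j}) x))" .
    qed
    also have "\<dots> = (\<Sum>(i,j)\<in>Q. \<integral>\<^sup>+x. ennreal (sep (x i) (x j) * par (I - {i, j}) x) \<partial>PiM I (\<lambda>_. M))"
      unfolding case_prod_unfold using less(2)
      by (subst nn_integral_sum) (auto simp: Q_def intro!: measurable_compose[OF _ measurable_ennreal] borel_measurable_times sep_measurable par_measurable measurable_component_singleton)
    also have "\<dots> \<le> (\<Sum>(i,j)\<in>Q. ennreal (4 * B) * X)"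
      unfolding case_prod_unfold by (intro sum_mono pair) (auto simp: Q_def)
    also have "\<dots> = of_nat (card Q) * (ennreal (4 * B) * X)"
      by simp
    also have "card Q = n * (n - 1)"
      unfolding Q_def using less(2) by (subst card_SigmaI) (auto simp: n_def)
    also have "of_nat (n * (n - 1)) * (ennreal (4 * B) * X) = ennreal (real (n * (n - 1)) * (4 * B * (fact (n - 2) * (4 * B) ^ ((n - 2) div 2))))"
      unfolding X_def using B0 by (simp only: ennreal_of_nat_eq_real_of_nat ennreal_mult''[symmetric] mult_nonneg_nonneg zero_le_numeral zero_le_power fact_ge_zero of_nat_0_le_iff)
    also have "real (n * (n - 1)) * (4 * B * (fact (n - 2) * (4 * B) ^ ((n - 2) div 2))) = fact n * (4 * B) ^ (n div 2)"
    proof -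
      obtain k where k: "n = Suc (Suc k)" using n(1) by (metis Suc_le_D numeral_2_eq_2 Suc_le_mono)
      then show ?thesis using n(2) by (simp add: algebra_simps)
    qed
    finally show ?thesis unfolding n_def .
  qed
qed

end

section \<open>Moments of the transform of a random perturbation\<close>

definition phase :: "real \<Rightarrow> complex" where
  "phase t = cis (- (2 * pi * t))"

lemma phase_add: "phase (s + t) = phase s * phase t"
  by (simp add: phase_def cis_mult algebra_simps)

lemma phase_0 [simp]: "phase 0 = 1"
  by (simp add: phase_def)

lemma phase_sum: "finite I \<Longrightarrow> phase (\<Sum>i\<in>I. f i) = (\<Prod>i\<in>I. phase (f i))"
  by (induction I rule: finite_induct) (auto simp: phase_add)

lemma cnj_phase: "cnj (phase t) = phase (- t)"
  by (simp add: phase_def cis_cnj)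

lemma norm_phase [simp]: "norm (phase t) = 1"
  by (simp add: phase_def)

lemma continuous_on_phase [continuous_intros]:
  "continuous_on A f \<Longrightarrow> continuous_on A (\<lambda>x. phase (f x))"
  unfolding phase_def cis_conv_exp by (intro continuous_intros)

lemma phase_measurable [measurable]: "phase \<in> borel_measurable borel"
  by (intro borel_measurable_continuous_onI continuous_intros)

lemma (in prob_space) integrable_phase [simp]:
  "f \<in> borel_measurable M \<Longrightarrow> integrable M (\<lambda>x. phase (f x))"
  by (rule integrable_const_bound[of _ 1]) auto

text \<open>This needs no measurability of \<open>f\<close>, since a non-integrable integrand has
  integral 0.\<close>

lemma (in prob_space) norm_integral_phase_le: "norm (\<integral>x. phase (f x) \<partial>M) \<le> 1"
proof (cases "integrable M (\<lambda>x. phase (f x))")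
  case True
  have "norm (\<integral>x. phase (f x) \<partial>M) \<le> (\<integral>x. norm (phase (f x)) \<partial>M)"
    by (rule integral_norm_bound)
  then show ?thesis by (simp add: prob_space)
qed (simp add: not_integrable_integral_eq)

text \<open>Independence over a possibly infinite index set: the integrand sees only the coordinates
  in \<open>J\<close>, whose joint law is the finite product.\<close>

lemma integral_PiM_finite_prod:
  fixes g :: "'i \<Rightarrow> 'a \<Rightarrow> 'b::{real_normed_field,banach,second_countable_topology}"
  assumes K: "\<And>i. prob_space (K i)" and J: "finite J" "J \<subseteq> I"
    and int: "\<And>i. i \<in> J \<Longrightarrow> integrable (K i) (g i)"
  shows "(\<integral>w. (\<Prod>i\<in>J. g i (w i)) \<partial>PiM I K) = (\<Prod>i\<in>J. \<integral>x. g i x \<partial>K i)"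
proof -
  interpret product_prob_space K I
    using K by (auto simp: product_prob_space_def product_prob_space_axioms_def product_sigma_finite_def
        prob_space_imp_sigma_finite)
  have [measurable]: "(\<lambda>w. \<Prod>i\<in>J. g i (w i)) \<in> borel_measurable (PiM J K)"
    using int by (intro borel_measurable_prod measurable_compose[OF measurable_component_singleton]) auto
  have "(\<Prod>i\<in>J. \<integral>x. g i x \<partial>K i) = (\<integral>w. (\<Prod>i\<in>J. g i (w i)) \<partial>PiM J K)"
    using J int by (intro product_integral_prod[symmetric]) auto
  also have "\<dots> = (\<integral>w. (\<Prod>i\<in>J. g i (w i)) \<partial>distr (PiM I K) (PiM J K) (\<lambda>w. restrict w J))"
    using distr_PiM_restrict_finite[OF J] by simp
  also have "\<dots> = (\<integral>w. (\<Prod>i\<in>J. g i (restrict w J i)) \<partial>PiM I K)"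
    using J by (intro integral_distr measurable_restrict_subset) auto
  also have "\<dots> = (\<integral>w. (\<Prod>i\<in>J. g i (w i)) \<partial>PiM I K)"
    by (intro Bochner_Integration.integral_cong prod.cong) auto
  finally show ?thesis by simp
qed

text \<open>Arbitrary maps \<open>g\<close> and \<open>h\<close> into the two spaces let this serve
  a fixed perturbation, the pair space, and each of the \<open>2q\<close> points alike.\<close>

lemma perturbation_measurable:
  fixes M :: "real measure" and K :: "'u \<Rightarrow> real measure"
  assumes M: "(\<lambda>x. x) \<in> borel_measurable M" and K: "\<And>u. (\<lambda>x. x) \<in> borel_measurable (K u)"
    and T: "T \<subseteq> G" "\<And>u. u \<in> T \<Longrightarrow> Measurable.pred M (b u)"
    and g: "g \<in> N \<rightarrow>\<^sub>M PiM G K" and h: "h \<in> N \<rightarrow>\<^sub>M M"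
  shows "(\<lambda>z. h z + (\<Sum>u\<in>T. of_bool (b u (h z)) * g z u)) \<in> borel_measurable N"
proof -
  have [measurable]: "Measurable.pred N (\<lambda>z. b u (h z))" if "u \<in> T" for u
    using measurable_compose[OF h T(2)[OF that]] by simp
  have [measurable]: "(\<lambda>z. g z u) \<in> borel_measurable N" if "u \<in> T" for u
    using that T(1)
    by (intro measurable_compose[OF g measurable_compose[OF measurable_component_singleton[of u G K] K]]) auto
  have [measurable]: "h \<in> borel_measurable N" using measurable_compose[OF h M] .
  show ?thesis unfolding of_bool_def by measurable
qed

lemma transform_measurable:
  fixes M :: "real measure" and K :: "'u \<Rightarrow> real measure"
  assumes "sigma_finite_measure M" "(\<lambda>x. x) \<in> borel_measurable M" "\<And>u. (\<lambda>x. x) \<in> borel_measurable (K u)"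
    "T \<subseteq> G" "\<And>u. u \<in> T \<Longrightarrow> Measurable.pred M (b u)"
  shows "(\<lambda>\<omega>. \<integral>x. phase (\<xi> * (x + (\<Sum>u\<in>T. of_bool (b u x) * \<omega> u))) \<partial>M) \<in> borel_measurable (PiM G K)"
proof -
  have "(\<lambda>p. phase (\<xi> * (snd p + (\<Sum>u\<in>T. of_bool (b u (snd p)) * fst p u)))) \<in> borel_measurable (PiM G K \<Otimes>\<^sub>M M)"
    by (intro measurable_compose[OF _ phase_measurable] borel_measurable_times borel_measurable_const
        perturbation_measurable[of M K T G b] assms measurable_fst measurable_snd)
  then show ?thesis
    by (intro sigma_finite_measure.borel_measurable_lebesgue_integral assms) (simp add: case_prod_unfold)
qed

section \<open>Even moments for finitely many gaps\<close>

context separated_measure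
begin

lemma ident_measurable: "(\<lambda>x. x) \<in> borel_measurable M"
  by (subst measurable_cong_sets[OF sets_M refl])
    (use measurable_restrict_space1[OF measurable_ident, of borel "space M"] in \<open>simp add: id_def\<close>)

text \<open>For fixed points, independence turns the expectation into a product over
  \<open>T\<close> of transforms of the \<open>K u\<close>. Elements of \<open>T\<close> outside
  \<open>S\<close> are estimated by 1, so the bound does not depend on \<open>T\<close>; this allows
  a later passage to all gaps.\<close>

lemma moment_bound:
  fixes K :: "'u \<Rightarrow> real measure" and \<xi> :: real and q :: nat
  assumes K: "\<And>u. prob_space (K u)" "\<And>u. (\<lambda>x. x) \<in> borel_measurable (K u)"
    and T: "finite T" "T \<subseteq> G" "S \<subseteq> T" "\<And>u. u \<in> T \<Longrightarrow> Measurable.pred M (b u)"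
    and half: "\<And>u k. u \<in> S \<Longrightarrow> k \<noteq> 0 \<Longrightarrow> norm (\<integral>w. phase (\<xi> * of_int k * w) \<partial>K u) \<le> 1/2"
  shows "(\<integral>\<^sup>+\<omega>. ennreal (norm (\<integral>x. phase (\<xi> * (x + (\<Sum>u\<in>T. of_bool (b u x) * \<omega> u))) \<partial>M) ^ (2 * q)) \<partial>PiM G K)
    \<le> ennreal (fact (2 * q) * (4 * B) ^ q)"
proof -
  define I where "I = {..<2 * q}"
  \<comment> \<open>The sign \<open>-1\<close> marks the \<open>q\<close> conjugate factors of
    \<open>(Z \<omega> * cnj (Z \<omega>)) ^ q\<close>.\<close>
  define \<sigma> :: "nat \<Rightarrow> int" where "\<sigma> i = (if i < q then 1 else - 1)" for i
  define P where "P = PiM G K"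
  define \<Lambda> where "\<Lambda> = PiM I (\<lambda>_. M)"
  define f where "f \<omega> x = x + (\<Sum>u\<in>T. of_bool (b u x) * \<omega> u)" for \<omega> x
  define Z where "Z \<omega> = (\<integral>x. phase (\<xi> * f \<omega> x) \<partial>M)" for \<omega>
  define H where "H \<omega> x = (\<Prod>i\<in>I. phase (\<xi> * \<sigma> i * f \<omega> (x i)))" for \<omega> x
  have I: "finite I" "card I = 2 * q" by (auto simp: I_def)
  interpret P: prob_space P unfolding P_def by (intro prob_space_PiM K)
  interpret \<Lambda>: prob_space \<Lambda> unfolding \<Lambda>_def by (intro prob_space_PiM prob_space_axioms)
  interpret PL: pair_sigma_finite P \<Lambda> by unfold_locales
  interpret PL: pair_prob_space P \<Lambda> by unfold_locales
  interpret LM: product_sigma_finite "\<lambda>_::nat. M" by unfold_locales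
  have f_meas: "(\<lambda>z. f (g z) (h z)) \<in> borel_measurable N" if "g \<in> N \<rightarrow>\<^sub>M P" "h \<in> N \<rightarrow>\<^sub>M M" for g h N
    unfolding f_def using that T unfolding P_def
    by (intro perturbation_measurable[of M K T G b] ident_measurable K)
  have H_meas: "(\<lambda>z. H (fst z) (snd z)) \<in> borel_measurable (P \<Otimes>\<^sub>M \<Lambda>)"
    unfolding H_def \<Lambda>_def
    by (intro borel_measurable_prod measurable_compose[OF _ phase_measurable] borel_measurable_times borel_measurable_const f_meas
          measurable_fst measurable_compose[OF measurable_snd measurable_component_singleton])
  have H_norm: "norm (H \<omega> x) = 1" for \<omega> x
    by (simp add: H_def prod_norm[symmetric])
  have H_int: "integrable (P \<Otimes>\<^sub>M \<Lambda>) (case_prod H)"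
    using H_meas by (intro PL.integrable_const_bound[of _ 1]) (auto simp: case_prod_unfold H_norm)
  have ZH: "complex_of_real (norm (Z \<omega>) ^ (2 * q)) = (\<integral>x. H \<omega> x \<partial>\<Lambda>)" if "\<omega> \<in> space P" for \<omega>
  proof -
    have fM: "(\<lambda>x. f \<omega> x) \<in> borel_measurable M" using that by (intro f_meas) auto
    have "complex_of_real (norm (Z \<omega>) ^ (2 * q)) = (Z \<omega> * cnj (Z \<omega>)) ^ q"
      by (simp add: complex_norm_square[symmetric] power_mult)
    also have "\<dots> = (\<Prod>i<q. Z \<omega>) * (\<Prod>i\<in>{q..<2 * q}. cnj (Z \<omega>))"
      by (simp add: power_mult_distrib)
    also have "\<dots> = (\<Prod>i\<in>I. if i < q then Z \<omega> else cnj (Z \<omega>))"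
    proof -
      have "I = {..<q} \<union> {q..<2 * q}" by (auto simp: I_def)
      moreover have "(\<Prod>i<q. Z \<omega>) = (\<Prod>i<q. if i < q then Z \<omega> else cnj (Z \<omega>))"
        by (intro prod.cong) auto
      moreover have "(\<Prod>i\<in>{q..<2 * q}. cnj (Z \<omega>)) = (\<Prod>i\<in>{q..<2 * q}. if i < q then Z \<omega> else cnj (Z \<omega>))"
        by (intro prod.cong) auto
      ultimately show ?thesis by (simp only:) (subst prod.union_disjoint; auto)
    qed
    also have "\<dots> = (\<Prod>i\<in>I. \<integral>x. phase (\<xi> * \<sigma> i * f \<omega> x) \<partial>M)"
    proof (intro prod.cong refl)
      fix i
      have "cnj (Z \<omega>) = (\<integral>x. cnj (phase (\<xi> * f \<omega> x)) \<partial>M)"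
        unfolding Z_def using fM by (intro integral_bounded_linear[OF bounded_linear_cnj, symmetric] integrable_phase) auto
      then show "(if i < q then Z \<omega> else cnj (Z \<omega>)) = (\<integral>x. phase (\<xi> * \<sigma> i * f \<omega> x) \<partial>M)"
        by (auto simp: Z_def \<sigma>_def cnj_phase)
    qed
    also have "\<dots> = (\<integral>x. (\<Prod>i\<in>I. phase (\<xi> * \<sigma> i * f \<omega> (x i))) \<partial>\<Lambda>)"
      unfolding \<Lambda>_def using fM I by (intro LM.product_integral_prod[symmetric] integrable_phase) auto
    finally show ?thesis by (simp add: H_def)
  qed
  have HP: "norm (\<integral>\<omega>. H \<omega> x \<partial>P) \<le> par I x" for x
  proof -
    \<comment> \<open>The integer frequency that \<open>\<omega> u\<close> receives. Signs do not
      affect parity, so an odd number of points to the right of \<open>u\<close> makes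
      \<open>k u\<close> odd, hence nonzero, and \<open>half\<close> applies.\<close>
    define k where "k u = (\<Sum>i\<in>I. \<sigma> i * of_bool (b u (x i)))" for u
    have odd_k: "odd (k u) \<longleftrightarrow> odd (\<Sum>i\<in>I. of_bool (b u (x i)) :: nat)" for u
    proof -
      have "even (\<Sum>i\<in>J. \<sigma> i * of_bool (b u (x i))) \<longleftrightarrow> even (\<Sum>i\<in>J. of_bool (b u (x i)) :: nat)" if "finite J" for J
        using that by (induction J rule: finite_induct)
          (auto simp: \<sigma>_def simp del: sum_of_bool_eq sum_mult_of_bool_eq sum_of_bool_mult_eq)
      then show ?thesis using I unfolding k_def by blast
    qed
    have H_eq: "H \<omega> x = phase (\<xi> * (\<Sum>i\<in>I. \<sigma> i * x i)) * (\<Prod>u\<in>T. phase (\<xi> * of_int (k u) * \<omega> u))" for \<omega>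
    proof -
      have "(\<Sum>i\<in>I. \<xi> * \<sigma> i * f \<omega> (x i)) = \<xi> * (\<Sum>i\<in>I. \<sigma> i * x i) + (\<Sum>i\<in>I. \<Sum>u\<in>T. \<xi> * (\<sigma> i * of_bool (b u (x i))) * \<omega> u)"
        by (simp add: f_def distrib_left sum.distrib sum_distrib_left mult_ac)
      also have "(\<Sum>i\<in>I. \<Sum>u\<in>T. \<xi> * (\<sigma> i * of_bool (b u (x i))) * \<omega> u) = (\<Sum>u\<in>T. \<Sum>i\<in>I. \<xi> * (\<sigma> i * of_bool (b u (x i))) * \<omega> u)"
        by (rule sum.swap)
      also have "\<dots> = (\<Sum>u\<in>T. \<xi> * of_int (k u) * \<omega> u)"
        by (simp add: k_def sum_distrib_left sum_distrib_right)
      finally show ?thesis unfolding H_def using I T by (simp add: phase_sum[symmetric] phase_add[symmetric])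
    qed
    have "(\<integral>\<omega>. H \<omega> x \<partial>P) = phase (\<xi> * (\<Sum>i\<in>I. \<sigma> i * x i)) * (\<integral>\<omega>. (\<Prod>u\<in>T. phase (\<xi> * of_int (k u) * \<omega> u)) \<partial>P)"
      unfolding H_eq by simp
    also have "(\<integral>\<omega>. (\<Prod>u\<in>T. phase (\<xi> * of_int (k u) * \<omega> u)) \<partial>P) = (\<Prod>u\<in>T. \<integral>w. phase (\<xi> * of_int (k u) * w) \<partial>K u)"
      unfolding P_def using T K
      by (intro integral_PiM_finite_prod prob_space.integrable_phase) auto
    finally have "norm (\<integral>\<omega>. H \<omega> x \<partial>P) = (\<Prod>u\<in>T. norm (\<integral>w. phase (\<xi> * of_int (k u) * w) \<partial>K u))"
      by (simp add: norm_mult prod_norm)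
    also have "\<dots> \<le> (\<Prod>u\<in>T. if u \<in> S then if even (\<Sum>i\<in>I. of_bool (b u (x i)) :: nat) then 1 else 1/2 else 1)"
    proof (intro prod_mono conjI norm_ge_zero)
      fix u assume "u \<in> T"
      have "norm (\<integral>w. phase (\<xi> * of_int (k u) * w) \<partial>K u) \<le> 1/2" if "u \<in> S" "odd (k u)"
        using that by (intro half) auto
      then show "norm (\<integral>w. phase (\<xi> * of_int (k u) * w) \<partial>K u) \<le> (if u \<in> S then if even (\<Sum>i\<in>I. of_bool (b u (x i)) :: nat) then 1 else 1/2 else 1)"
        using odd_k[of u] prob_space.norm_integral_phase_le[OF K(1)[of u]] by simp
    qed
    also have "\<dots> = par I x"
      unfolding par_def using T by (subst prod.inter_restrict[symmetric]) (auto simp: Int_absorb1)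
    finally show ?thesis .
  qed
  have Z_meas: "Z \<in> borel_measurable P"
    unfolding Z_def f_def P_def using T
    by (intro transform_measurable ident_measurable K sigma_finite_measure_axioms)
  have Z_le: "norm (Z \<omega>) \<le> 1" for \<omega> unfolding Z_def by (rule norm_integral_phase_le)
  have Z_int: "integrable P (\<lambda>\<omega>. norm (Z \<omega>) ^ (2 * q))"
    using Z_meas Z_le by (intro P.integrable_const_bound[of _ 1]) (auto simp: power_le_one)
  have par_le: "par I x \<le> 1" for x unfolding par_def by (rule prod_le_1) auto
  have par_int: "integrable \<Lambda> (par I)"
    unfolding \<Lambda>_def using par_le par_pos I
    by (intro \<Lambda>.integrable_const_bound[of _ 1, unfolded \<Lambda>_def] par_measurable) (auto simp: less_imp_le)
  have "complex_of_real (\<integral>\<omega>. norm (Z \<omega>) ^ (2 * q) \<partial>P) = (\<integral>\<omega>. \<integral>x. H \<omega> x \<partial>\<Lambda> \<partial>P)"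
    unfolding integral_complex_of_real[symmetric] by (intro Bochner_Integration.integral_cong ZH) auto
  also have "\<dots> = (\<integral>x. \<integral>\<omega>. H \<omega> x \<partial>P \<partial>\<Lambda>)"
    by (rule PL.Fubini_integral[OF H_int, symmetric])
  finally have "norm (\<integral>\<omega>. norm (Z \<omega>) ^ (2 * q) \<partial>P) = norm (\<integral>x. \<integral>\<omega>. H \<omega> x \<partial>P \<partial>\<Lambda>)"
    by (metis norm_of_real real_norm_def)
  also have "\<dots> \<le> (\<integral>x. par I x \<partial>\<Lambda>)"
    by (intro order_trans[OF integral_norm_bound] integral_mono integrable_norm PL.integrable_snd[OF H_int] par_int HP)
  finally have *: "(\<integral>\<omega>. norm (Z \<omega>) ^ (2 * q) \<partial>P) \<le> (\<integral>x. par I x \<partial>\<Lambda>)" by simp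
  have "(\<integral>\<^sup>+\<omega>. ennreal (norm (Z \<omega>) ^ (2 * q)) \<partial>P) = ennreal (\<integral>\<omega>. norm (Z \<omega>) ^ (2 * q) \<partial>P)"
    using Z_int by (intro nn_integral_eq_integral) auto
  also have "\<dots> \<le> ennreal (\<integral>x. par I x \<partial>\<Lambda>)" by (intro ennreal_leI *)
  also have "\<dots> = (\<integral>\<^sup>+x. ennreal (par I x) \<partial>\<Lambda>)"
    using par_int par_pos by (intro nn_integral_eq_integral[symmetric]) (auto simp: less_imp_le)
  also have "\<dots> \<le> ennreal (fact (card I) * (4 * B) ^ (card I div 2))"
    unfolding \<Lambda>_def using I by (intro nn_integral_par) auto
  finally show ?thesis using I(2) unfolding Z_def f_def P_def by simp
qed

end

section \<open>Lengths of gaps\<close>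

lemma delta_le:
  assumes "0 \<le> \<alpha>" "0 < t" "t \<le> l"
  shows "delta \<alpha> t \<le> max (1 / ln 2) (l powr \<alpha>)"
proof (cases "\<alpha> = 0")
  case True
  have "1 / max (- ln t) (ln 2) \<le> 1 / ln 2" by (intro divide_left_mono mult_pos_pos) (auto simp: less_max_iff_disj)
  then show ?thesis using True by (simp add: delta_def le_max_iff_disj)
next
  case False
  then show ?thesis using assms by (auto simp: delta_def le_max_iff_disj intro!: powr_mono2)
qed

text \<open>For \<open>\<alpha> = 0\<close> the loss \<open>\<eta>\<close> pays for the logarithm,
  by \<open>ln y < y\<close> at \<open>y = t powr (- \<eta>)\<close>. For
  \<open>\<alpha> > 0\<close> it costs the constant \<open>l powr (- \<eta>)\<close>, which is where
  the bound on \<open>t\<close> is used.\<close>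

lemma delta_ge:
  assumes "0 \<le> \<alpha>" "\<eta> > 0" "l > 0"
  shows "\<exists>c>0. \<forall>t. 0 < t \<and> t \<le> l \<longrightarrow> c * t powr (\<alpha> + \<eta>) \<le> delta \<alpha> t"
proof (cases "\<alpha> = 0")
  case True
  define c where "c = 1 / (1 / \<eta> + ln 2 * l powr \<eta>)"
  have c: "c > 0" unfolding c_def using assms by (intro divide_pos_pos add_pos_nonneg) auto
  have "c * t powr \<eta> \<le> 1 / max (- ln t) (ln 2)" if t: "0 < t" "t \<le> l" for t
  proof -
    have "ln (t powr (- \<eta>)) \<le> t powr (- \<eta>)" using t by (intro less_imp_le[OF ln_less_self]) auto
    then have "(- ln t) * \<eta> * t powr \<eta> \<le> t powr (- \<eta>) * t powr \<eta>"
      using t by (intro mult_right_mono) (auto simp: ln_powr mult.commute)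
    also have "t powr (- \<eta>) * t powr \<eta> = 1" using t by (simp add: powr_add[symmetric])
    finally have "(- ln t) * t powr \<eta> \<le> 1 / \<eta>" using assms by (simp add: field_simps)
    moreover have "ln 2 * t powr \<eta> \<le> ln 2 * l powr \<eta>"
      using t assms by (intro mult_left_mono powr_mono2) auto
    moreover have "0 \<le> 1 / \<eta>" "0 \<le> ln 2 * l powr \<eta>" using assms by auto
    ultimately have "(- ln t) * t powr \<eta> \<le> 1 / \<eta> + ln 2 * l powr \<eta>"
      "ln 2 * t powr \<eta> \<le> 1 / \<eta> + ln 2 * l powr \<eta>"
      by linarith+
    then have "max (- ln t) (ln 2) * t powr \<eta> \<le> 1 / \<eta> + ln 2 * l powr \<eta>"
      unfolding max_def by (cases "- ln t \<le> ln 2") simp_all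
    then have "max (- ln t) (ln 2) * t powr \<eta> \<le> 1 / c" by (simp add: c_def)
    moreover have "max (- ln t) (ln 2) > 0" by (simp add: less_max_iff_disj)
    ultimately show ?thesis using c by (simp add: field_simps)
  qed
  then show ?thesis using c True by (auto simp: delta_def)
next
  case False
  show ?thesis
  proof (intro exI[of _ "l powr (- \<eta>)"] conjI allI impI)
    fix t assume t: "0 < t \<and> t \<le> l"
    have "l powr (- \<eta>) * t powr (\<alpha> + \<eta>) = (l powr (- \<eta>) * t powr \<eta>) * t powr \<alpha>"
      using t by (simp add: powr_add)
    also have "\<dots> \<le> (l powr (- \<eta>) * l powr \<eta>) * t powr \<alpha>"
      using t assms by (intro mult_right_mono mult_left_mono powr_mono2) auto
    also have "\<dots> = delta \<alpha> t" using False assms by (simp add: delta_def powr_add[symmetric])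
    finally show "l powr (- \<eta>) * t powr (\<alpha> + \<eta>) \<le> delta \<alpha> t" .
  qed (use assms in auto)
qed

text \<open>For any set \<open>U\<close> the indicator is monotone in \<open>x\<close>, hence
  Borel.\<close>

lemma pred_left_of_measurable [measurable]: "Measurable.pred borel (\<lambda>x::real. U \<subseteq> {..<x})"
proof -
  have "mono (\<lambda>x::real. of_bool (U \<subseteq> {..<x}) :: real)"
    by (rule monoI) (auto simp: subset_iff intro: less_le_trans)
  then have [measurable]: "(\<lambda>x::real. of_bool (U \<subseteq> {..<x}) :: real) \<in> borel_measurable borel"
    by (rule borel_measurable_mono)
  have "Measurable.pred borel (\<lambda>x::real. of_bool (U \<subseteq> {..<x}) = (1 :: real))"
    by measurable
  then show ?thesis by simp
qed

context
  fixes E :: "real set"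
  assumes E: "compact E" "E \<noteq> {}"
begin

lemma gap_open: "U \<in> gaps E \<Longrightarrow> open U"
  using open_components[of "- E" U] compact_imp_closed[OF E(1)] by (auto simp: gaps_def)

lemma bdd_E: "bdd_above E" "bdd_below E"
  using compact_imp_bounded[OF E(1)] by (auto intro: bounded_imp_bdd_above bounded_imp_bdd_below)

text \<open>A component of the complement that reaches beyond an endpoint of \<open>E\<close>
  contains the whole ray there, so it is unbounded.\<close>

lemma gap_subset:
  assumes "U \<in> gaps E"
  shows "U \<subseteq> {Inf E..Sup E}"
proof
  fix x assume x: "x \<in> U"
  have U: "U \<in> components (- E)" "bounded U" using assms by (auto simp: gaps_def)
  note bdd = bdd_E
  have "x \<le> Sup E"
  proof (rule ccontr)
    assume "\<not> x \<le> Sup E"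
    then have "{Sup E<..} \<subseteq> U" using x cSup_upper[OF _ bdd(1)]
      by (intro components_maximal[OF U(1)]) force+
    then have "bdd_above {Sup E<..}" by (rule bdd_above_mono[OF bounded_imp_bdd_above[OF U(2)]])
    then obtain B where "\<And>y. Sup E < y \<Longrightarrow> y \<le> B" by (auto simp: bdd_above_def)
    from this[of "max B (Sup E) + 1"] show False by linarith
  qed
  moreover have "Inf E \<le> x"
  proof (rule ccontr)
    assume "\<not> Inf E \<le> x"
    then have "{..<Inf E} \<subseteq> U" using x cInf_lower[OF _ bdd(2)]
      by (intro components_maximal[OF U(1)]) force+
    then have "bdd_below {..<Inf E}" by (rule bdd_below_mono[OF bounded_imp_bdd_below[OF U(2)]])
    then obtain B where "\<And>y. y < Inf E \<Longrightarrow> B \<le> y" by (auto simp: bdd_below_def)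
    from this[of "min B (Inf E) - 1"] show False by linarith
  qed
  ultimately show "x \<in> {Inf E..Sup E}" by simp
qed

lemma gap_fmeasurable: "U \<in> gaps E \<Longrightarrow> U \<in> fmeasurable lborel"
  using gap_open[of U] emeasure_bounded_finite[of U] by (intro fmeasurableI) (auto simp: gaps_def)

lemma len_gap_pos:
  assumes "U \<in> gaps E"
  shows "0 < len U"
proof -
  have "U \<noteq> {}" using assms in_components_nonempty by (auto simp: gaps_def)
  then obtain x e where e: "e > 0" "ball x e \<subseteq> U" using gap_open[OF assms] by (meson all_not_in_conv openE)
  have "len {x - e<..<x + e} \<le> len U"
    using e by (intro measure_mono_fmeasurable gap_fmeasurable assms) (auto simp: ball_eq_greaterThanLessThan)
  then show ?thesis using e by simp
qed

lemma sum_len_gaps: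
  assumes "finite T" "T \<subseteq> gaps E"
  shows "(\<Sum>U\<in>T. len U) \<le> Sup E - Inf E"
proof -
  have "disjoint_family_on (\<lambda>U. U) T"
    using assms(2) components_nonoverlap[of _ "- E"] unfolding disjoint_family_on_def gaps_def by blast
  then have "(\<Sum>U\<in>T. len U) = len (\<Union>U\<in>T. U)"
    using assms gap_fmeasurable
    by (intro measure_UNION'[symmetric]) (auto simp: pairwise_def disjnt_def disjoint_family_on_def)
  also have "\<dots> \<le> len {Inf E..Sup E}"
  proof (rule measure_mono_fmeasurable)
    show "(\<Union>U\<in>T. U) \<subseteq> {Inf E..Sup E}" using assms gap_subset by blast
    show "(\<Union>U\<in>T. U) \<in> sets lborel" using assms gap_open by (auto intro!: borel_open)
    show "{Inf E..Sup E} \<in> fmeasurable lborel" by (rule fmeasurableI) (auto simp: emeasure_lborel_Icc_eq)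
  qed
  also have "\<dots> = Sup E - Inf E"
    using E bdd_E by (simp add: cInf_le_cSup)
  finally show ?thesis .
qed

lemma len_gap_le: "U \<in> gaps E \<Longrightarrow> len U \<le> Sup E - Inf E"
  using sum_len_gaps[of "{U}"] by simp

lemma summable_len_gaps: "len summable_on gaps E"
  using sum_len_gaps by (intro nonneg_bdd_above_summable_on) (auto intro!: bdd_aboveI)

lemma finite_large_gaps:
  assumes "\<rho> > 0"
  shows "finite {U \<in> gaps E. \<rho> \<le> len U}"
proof (rule ccontr)
  assume inf: "infinite {U \<in> gaps E. \<rho> \<le> len U}"
  obtain n where n: "Sup E - Inf E < real n * \<rho>"
    using reals_Archimedean3[OF assms] by blast
  obtain T where T: "finite T" "card T = n" "T \<subseteq> {U \<in> gaps E. \<rho> \<le> len U}"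
    using infinite_arbitrarily_large[OF inf] by blast
  have "real n * \<rho> = (\<Sum>U\<in>T. \<rho>)" using T by simp
  also have "\<dots> \<le> (\<Sum>U\<in>T. len U)" using T by (intro sum_mono) auto
  also have "\<dots> \<le> Sup E - Inf E" using T by (intro sum_len_gaps) auto
  finally show False using n by simp
qed

text \<open>As \<open>m > 0\<close>, one factor \<open>len U\<close> can be split off and the rest
  is bounded over all gaps. Summability of the weights thus reduces to that of the lengths.\<close>

lemma gap_delta_le:
  assumes "m > 0" "0 \<le> \<alpha>"
  shows "\<exists>C\<ge>0. \<forall>U\<in>gaps E. gap_delta m \<alpha> U \<le> C * len U"
proof (intro exI conjI ballI)
  define l where "l = Sup E - Inf E"
  show "0 \<le> \<bar>l\<bar> ^ (m - 1) * max (1 / ln 2) (l powr \<alpha>)"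
    by (intro mult_nonneg_nonneg) (auto simp: le_max_iff_disj)
  fix U assume U: "U \<in> gaps E"
  have l: "0 < len U" "len U \<le> l" using len_gap_pos[OF U] len_gap_le[OF U] by (auto simp: l_def)
  have "gap_delta m \<alpha> U = len U * (len U ^ (m - 1) * delta \<alpha> (len U))"
    unfolding gap_delta_def using assms(1) by (cases m) auto
  also have "\<dots> \<le> len U * (\<bar>l\<bar> ^ (m - 1) * max (1 / ln 2) (l powr \<alpha>))"
  proof (intro mult_left_mono mult_mono delta_le power_mono assms l)
    have "0 < max (- ln (len U)) (ln 2)" by (simp add: less_max_iff_disj)
    then show "0 \<le> delta \<alpha> (len U)" by (auto simp: delta_def)
  qed (use l in auto)
  finally show "gap_delta m \<alpha> U \<le> \<bar>l\<bar> ^ (m - 1) * max (1 / ln 2) (l powr \<alpha>) * len U" by (simp add: mult_ac)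
qed

lemma gap_delta_ge:
  assumes "0 \<le> \<alpha>" "\<eta> > 0"
  shows "\<exists>c>0. \<forall>U\<in>gaps E. c * len U powr (real m + \<alpha> + \<eta>) \<le> gap_delta m \<alpha> U"
proof -
  \<comment> \<open>The maximum with 1 keeps \<open>l\<close> positive when \<open>E\<close> is a
    single point.\<close>
  define l where "l = max 1 (Sup E - Inf E)"
  obtain c where c: "c > 0" "\<And>t. 0 < t \<Longrightarrow> t \<le> l \<Longrightarrow> c * t powr (\<alpha> + \<eta>) \<le> delta \<alpha> t"
    using delta_ge[OF assms, of l] unfolding l_def by fastforce
  show ?thesis
  proof (intro exI[of _ c] conjI ballI c(1))
    fix U assume U: "U \<in> gaps E"
    have l: "0 < len U" "len U \<le> l" using len_gap_pos[OF U] len_gap_le[OF U] by (auto simp: l_def)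
    have "c * len U powr (real m + \<alpha> + \<eta>) = len U ^ m * (c * len U powr (\<alpha> + \<eta>))"
      using l by (simp add: powr_add powr_realpow)
    also have "\<dots> \<le> gap_delta m \<alpha> U"
      unfolding gap_delta_def using l c(2)[OF l] by (intro mult_left_mono) auto
    finally show "c * len U powr (real m + \<alpha> + \<eta>) \<le> gap_delta m \<alpha> U" .
  qed
qed

text \<open>This makes the sum in \<open>f_map\<close> a genuine one for every point of
  \<open>Omega\<close>; a non-summable family would give \<open>infsum\<close> its default value
  0.\<close>

lemma summable_gap_delta:
  assumes "m > 0" "0 \<le> \<alpha>"
  shows "gap_delta m \<alpha> summable_on gaps E"
proof -
  obtain C where C: "C \<ge> 0" "\<And>U. U \<in> gaps E \<Longrightarrow> gap_delta m \<alpha> U \<le> C * len U"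
    using gap_delta_le[OF assms] by blast
  show ?thesis
    by (rule summable_on_comparison_test[OF summable_on_cmult_right[OF summable_len_gaps, of C]])
      (use C gap_delta_nonneg in auto)
qed

end

section \<open>Polynomial decay from moment bounds\<close>

lemma norm_phase_diff_le: "norm (phase s - phase t) \<le> 2 * pi * \<bar>s - t\<bar>"
proof -
  have "phase s - phase t = phase t * (phase (s - t) - 1)"
    by (simp add: right_diff_distrib phase_add[symmetric])
  then have "norm (phase s - phase t) = norm (exp (\<i> * of_real (- (2 * pi * (s - t)))) - 1)"
    by (simp add: norm_mult phase_def cis_conv_exp)
  also have "\<dots> = 2 * \<bar>sin (- (2 * pi * (s - t)) / 2)\<bar>" by (rule dist_exp_i_1)
  also have "\<dots> \<le> 2 * \<bar>- (2 * pi * (s - t)) / 2\<bar>" by (intro mult_left_mono abs_sin_x_le_abs_x) auto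
  finally show ?thesis by (simp add: abs_mult)
qed

text \<open>Between consecutive grid points \<open>sqrt k\<close> the function varies by at most \<open>L / \<xi>\<close>, which is
  smaller than the decay to be proved since \<open>p \<le> 1\<close>.\<close>
lemma decay_from_sqrt_grid:
  fixes g :: "real \<Rightarrow> real"
  assumes nonneg: "\<And>\<xi>. 0 \<le> g \<xi>" and le1: "\<And>\<xi>. g \<xi> \<le> 1" and even: "\<And>\<xi>. g (- \<xi>) = g \<xi>"
    and lip: "\<And>\<xi> \<zeta>. \<bar>g \<xi> - g \<zeta>\<bar> \<le> L * \<bar>\<xi> - \<zeta>\<bar>" and "L \<ge> 0"
    and grid: "\<And>k. k \<ge> 1 \<Longrightarrow> g (sqrt (real k)) * real k powr (p / 4) \<le> C"
    and p: "0 < p" "p \<le> 1"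
  shows "bounded (range (\<lambda>\<xi>. g \<xi> * rpow \<bar>\<xi>\<bar> (p / 2)))"
proof -
  have C: "C \<ge> 0" using grid[of 1] nonneg[of 1] by simp
  have pos: "g \<xi> * rpow \<bar>\<xi>\<bar> (p / 2) \<le> 1 + 2 * C + L" if "\<xi> \<ge> 0" for \<xi>
  proof (cases "\<xi> < 1")
    case True
    have "\<xi> powr (p / 2) \<le> 1" using that True p by (intro powr_le1) auto
    then have "rpow \<bar>\<xi>\<bar> (p / 2) \<le> 1" using that p by (simp add: rpow_def)
    then have "g \<xi> * rpow \<bar>\<xi>\<bar> (p / 2) \<le> 1 * 1"
      by (intro mult_mono le1 nonneg) (auto simp: rpow_def)
    then show ?thesis using C \<open>L \<ge> 0\<close> by simp
  next
    case False
    \<comment> \<open>\<open>sqrt k\<close> is the last grid point up to \<open>\<xi>\<close>. From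
      \<open>(\<xi> - sqrt k) * (\<xi> + sqrt k) = \<xi>\<^sup>2 - k \<le> 1\<close> its distance to
      \<open>\<xi>\<close> is at most \<open>1 / \<xi>\<close>.\<close>
    define k where "k = nat \<lfloor>\<xi>\<^sup>2\<rfloor>"
    have "1 \<le> \<xi>\<^sup>2" using False by simp
    then have "1 \<le> \<lfloor>\<xi>\<^sup>2\<rfloor>" by linarith
    then have k: "k \<ge> 1" "real k \<le> \<xi>\<^sup>2" "\<xi>\<^sup>2 < real k + 1"
      unfolding k_def by linarith+
    have sk: "sqrt (real k) \<le> \<xi>" "0 \<le> sqrt (real k)" using k False by (auto simp: real_le_lsqrt)
    have "(\<xi> - sqrt (real k)) * \<xi> \<le> (\<xi> - sqrt (real k)) * (\<xi> + sqrt (real k))"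
      using sk by (intro mult_left_mono) auto
    also have "\<dots> = \<xi>\<^sup>2 - real k" by (simp add: algebra_simps power2_eq_square)
    also have "\<dots> \<le> 1" using k by simp
    finally have d: "\<xi> - sqrt (real k) \<le> 1 / \<xi>" using False by (simp add: field_simps)
    have "g \<xi> \<le> g (sqrt (real k)) + L * (\<xi> - sqrt (real k))"
      using lip[of \<xi> "sqrt (real k)"] sk by simp
    also have "\<dots> \<le> g (sqrt (real k)) + L * (1 / \<xi>)"
      using d \<open>L \<ge> 0\<close> by (intro add_left_mono mult_left_mono) auto
    finally have g: "g \<xi> \<le> g (sqrt (real k)) + L / \<xi>" by simp
    \<comment> \<open>As \<open>\<xi>\<^sup>2 < k + 1 \<le> 2 * k\<close>, replacing
      \<open>\<xi>\<close> by the grid point costs a factor of at most 2. The exponent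
      \<open>p / 4\<close> is \<open>p / 2\<close> for the square root.\<close>
    have "\<xi> powr (p / 2) = (\<xi> powr 2) powr (p / 4)" using False by (simp add: powr_powr del: powr_numeral)
    also have "\<xi> powr 2 = \<xi>\<^sup>2" using False by simp
    also have "(\<xi>\<^sup>2) powr (p / 4) \<le> (2 * real k) powr (p / 4)"
      using k p by (intro powr_mono2) auto
    also have "\<dots> = 2 powr (p / 4) * real k powr (p / 4)" by (simp add: powr_mult)
    also have "\<dots> \<le> 2 powr 1 * real k powr (p / 4)" using p by (intro mult_right_mono powr_mono) auto
    finally have pw: "\<xi> powr (p / 2) \<le> 2 * real k powr (p / 4)" by simp
    have "\<xi> powr (p / 2) \<le> \<xi> powr 1" using False p by (intro powr_mono) auto
    then have pw2: "\<xi> powr (p / 2) / \<xi> \<le> 1" using False by simp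
    have "g \<xi> * \<xi> powr (p / 2) \<le> (g (sqrt (real k)) + L / \<xi>) * \<xi> powr (p / 2)"
      using g by (intro mult_right_mono) auto
    also have "\<dots> = g (sqrt (real k)) * \<xi> powr (p / 2) + L * (\<xi> powr (p / 2) / \<xi>)"
      by (simp add: algebra_simps)
    also have "\<dots> \<le> g (sqrt (real k)) * (2 * real k powr (p / 4)) + L * 1"
      using pw pw2 nonneg \<open>L \<ge> 0\<close> by (intro add_mono mult_left_mono) auto
    also have "\<dots> \<le> 2 * C + L" using grid[OF k(1)] by simp
    finally show ?thesis using False by (simp add: rpow_def)
  qed
  show ?thesis
  proof (rule boundedI)
    fix y assume "y \<in> range (\<lambda>\<xi>. g \<xi> * rpow \<bar>\<xi>\<bar> (p / 2))"
    then obtain \<xi> where y: "y = g \<xi> * rpow \<bar>\<xi>\<bar> (p / 2)" by auto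
    have "g \<xi> = g \<bar>\<xi>\<bar>" using even by (simp add: abs_if)
    then have "y \<le> 1 + 2 * C + L" using pos[of "\<bar>\<xi>\<bar>"] y by simp
    moreover have "0 \<le> y" using nonneg y by (auto simp: rpow_def)
    ultimately show "norm y \<le> 1 + 2 * C + L" by simp
  qed
qed

text \<open>The sum of all the powers has finite expectation, so it is finite almost everywhere and
  bounds each of its terms.\<close>

lemma (in prob_space) AE_bounded_from_moments:
  fixes Y :: "nat \<Rightarrow> 'a \<Rightarrow> real"
  assumes meas: "\<And>k. Y k \<in> borel_measurable M" and nonneg: "\<And>k \<omega>. 0 \<le> Y k \<omega>"
    and mom: "\<And>k. k \<ge> 1 \<Longrightarrow> (\<integral>\<^sup>+\<omega>. ennreal (Y k \<omega> ^ (2 * q)) \<partial>M) \<le> ennreal (C * real k powr (- 2))"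
    and "q > 0" "C \<ge> 0"
  shows "AE \<omega> in M. \<exists>c. \<forall>k\<ge>1. Y k \<omega> \<le> c"
proof -
  \<comment> \<open>The shift by \<open>Suc\<close> leaves out \<open>k = 0\<close>, for which there
    is no moment bound.\<close>
  define X where "X k \<omega> = ennreal (Y (Suc k) \<omega> ^ (2 * q))" for k \<omega>
  have [measurable]: "X k \<in> borel_measurable M" for k
    unfolding X_def using meas by measurable
  have sm: "summable (\<lambda>k. C * real (Suc k) powr (- 2))"
    using summable_Suc_iff[of "\<lambda>k. C * real k powr (- 2)"]
    by (simp add: summable_real_powr_iff summable_mult)
  have "(\<integral>\<^sup>+\<omega>. (\<Sum>k. X k \<omega>) \<partial>M) = (\<Sum>k. \<integral>\<^sup>+\<omega>. X k \<omega> \<partial>M)"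
    by (intro nn_integral_suminf) auto
  also have "\<dots> \<le> (\<Sum>k. ennreal (C * real (Suc k) powr (- 2)))"
    unfolding X_def by (intro suminf_le mom) auto
  also have "\<dots> = ennreal (\<Sum>k. C * real (Suc k) powr (- 2))"
    using \<open>C \<ge> 0\<close> sm by (intro suminf_ennreal2) auto
  also have "\<dots> < \<infinity>" by simp
  finally have "(\<integral>\<^sup>+\<omega>. (\<Sum>k. X k \<omega>) \<partial>M) \<noteq> \<infinity>" by simp
  then have "AE \<omega> in M. (\<Sum>k. X k \<omega>) \<noteq> \<infinity>"
    by (intro nn_integral_PInf_AE) auto
  then show ?thesis
  proof eventually_elim
    case (elim \<omega>)
    define s where "s = enn2real (\<Sum>k. X k \<omega>)"
    have "Y k \<omega> \<le> max 1 s" if "k \<ge> 1" for k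
    proof -
      have "X (k - 1) \<omega> = (\<Sum>k\<in>{k - 1}. X k \<omega>)" by simp
      also have "\<dots> \<le> (\<Sum>k. X k \<omega>)" by (intro sum_le_suminf) auto
      also have "\<dots> = ennreal s" using elim by (simp add: s_def ennreal_enn2real_if)
      finally have "ennreal (Y k \<omega> ^ (2 * q)) \<le> ennreal s" using that by (simp add: X_def)
      then have Ys: "Y k \<omega> ^ (2 * q) \<le> s" by (simp add: s_def enn2real_nonneg)
      show ?thesis
      proof (cases "Y k \<omega> \<le> 1")
        case False
        then have "Y k \<omega> \<le> Y k \<omega> ^ (2 * q)" using \<open>q > 0\<close> by (intro self_le_power) auto
        then show ?thesis using Ys by simp
      qed simp
    qed
    then show ?case by blast
  qed
qed

section \<open>The random image measure\<close>

lemma fourier_transform_phase: "fourier_transform \<mu> \<xi> = (\<integral>x. phase (\<xi> * x) \<partial>\<mu>)"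
  unfolding fourier_transform_def phase_def cis_conv_exp
  by (intro Bochner_Integration.integral_cong) (auto simp: algebra_simps)

locale random_image =
  fixes m :: nat and \<alpha> :: real and E :: "real set" and \<nu> lam :: "real measure"
  assumes m: "m > 0" and \<alpha>: "0 \<le> \<alpha>" and E: "compact E" "E \<noteq> {}"
    and \<nu>: "borel_prob_on {0..1} \<nu>" and lam: "borel_prob_on E lam"
begin

abbreviation "gd \<equiv> gap_delta m \<alpha>"

definition K :: "real set \<Rightarrow> real measure" where
  "K U = distr \<nu> (restrict_space borel {0..gd U}) (\<lambda>x. gd U * x)"

text \<open>An exhaustion of the gaps by finite sets: it replaces the sum in \<open>f_map\<close> by
  finite sums, to which \<open>moment_bound\<close> applies.\<close>

definition T :: "nat \<Rightarrow> real set set" where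
  "T n = {U \<in> gaps E. 1 / real (Suc n) \<le> len U}"

definition FT :: "real \<Rightarrow> (real set \<Rightarrow> real) \<Rightarrow> complex" where
  "FT \<xi> \<omega> = fourier_transform (distr lam borel (f_map E \<omega>)) \<xi>"

lemma P_measure_eq: "P_measure m \<alpha> E \<nu> = PiM (gaps E) K"
  by (simp add: P_measure_def K_def[abs_def])

sublocale lam: prob_space lam
  using lam by (simp add: borel_prob_on_def)

lemma sets_lam: "sets lam = sets (restrict_space borel E)"
  using lam by (simp add: borel_prob_on_def)

lemma space_lam: "space lam = E"
  using sets_eq_imp_space_eq[OF sets_lam] by (simp add: space_restrict_space)

lemma lam_measurable:
  assumes "f \<in> borel_measurable borel"
  shows "f \<in> borel_measurable lam"
  by (subst measurable_cong_sets[OF sets_lam refl]) (rule measurable_restrict_space1[OF assms])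

lemma left_of_pred: "Measurable.pred lam (\<lambda>x. U \<subseteq> {..<x})"
  by (subst measurable_cong_sets[OF sets_lam refl])
    (rule measurable_restrict_space1[OF pred_left_of_measurable])

lemma scale_measurable: "(\<lambda>x. gd U * x) \<in> \<nu> \<rightarrow>\<^sub>M restrict_space borel {0..gd U}"
proof -
  have "(\<lambda>x. gd U * x) \<in> restrict_space borel {0..1} \<rightarrow>\<^sub>M restrict_space borel {0..gd U}"
    by (intro measurable_restrict_space3) (auto intro!: mult_nonneg_nonneg mult_left_le gap_delta_nonneg)
  moreover have "sets \<nu> = sets (restrict_space borel {0..1})"
    using \<nu> by (simp add: borel_prob_on_def)
  ultimately show ?thesis using measurable_cong_sets by blast
qed

lemma prob_space_K: "prob_space (K U)"
  unfolding K_def using \<nu> scale_measurable by (auto simp: borel_prob_on_def intro!: prob_space.prob_space_distr)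

lemma K_measurable: "f \<in> borel_measurable borel \<Longrightarrow> f \<in> borel_measurable (K U)"
  unfolding K_def by (simp add: measurable_restrict_space1)

lemma integral_phase_K: "(\<integral>w. phase (t * w) \<partial>K U) = fourier_transform \<nu> (t * gd U)"
  unfolding K_def fourier_transform_phase
  by (subst integral_distr[OF scale_measurable]) (auto intro!: measurable_restrict_space1 simp: mult.assoc)

lemma OmegaD:
  assumes "\<omega> \<in> Omega m \<alpha> E" "U \<in> gaps E"
  shows "0 \<le> \<omega> U" "\<omega> U \<le> gd U"
  using PiE_mem[OF assms[unfolded Omega_def]] by auto

lemma summable_Omega:
  assumes "\<omega> \<in> Omega m \<alpha> E" "G \<subseteq> gaps E"
  shows "\<omega> summable_on G"
  using summable_gap_delta[OF E m \<alpha>] OmegaD[OF assms(1)]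
  by (intro summable_on_subset_banach[OF _ assms(2)]) (rule summable_on_comparison_test[of gd], auto)

text \<open>Passing to a larger point only adds nonnegative weights, so the map is monotone.\<close>

lemma f_map_measurable:
  assumes "\<omega> \<in> Omega m \<alpha> E"
  shows "f_map E \<omega> \<in> borel_measurable borel"
proof (rule borel_measurable_mono, rule monoI)
  fix x y :: real assume "x \<le> y"
  then show "f_map E \<omega> x \<le> f_map E \<omega> y"
    unfolding f_map_def using OmegaD[OF assms] summable_Omega[OF assms]
    by (intro add_mono infsum_mono_neutral) (auto simp: subset_iff intro: less_le_trans)
qed

lemma f_map_bound:
  assumes "\<omega> \<in> Omega m \<alpha> E"
  shows "\<bar>f_map E \<omega> x\<bar> \<le> \<bar>x\<bar> + infsum gd (gaps E)"
proof -
  define G where "G = {U \<in> gaps E. U \<subseteq> {..<x}}"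
  have "0 \<le> infsum \<omega> G" using OmegaD[OF assms] by (intro infsum_nonneg) (auto simp: G_def)
  moreover have "infsum \<omega> G \<le> infsum gd (gaps E)"
    using OmegaD[OF assms] summable_Omega[OF assms] summable_gap_delta[OF E m \<alpha>] gap_delta_nonneg
    by (intro infsum_mono_neutral) (auto simp: G_def)
  ultimately show ?thesis unfolding f_map_def G_def[symmetric] by linarith
qed

lemma FT_eq:
  assumes "\<omega> \<in> Omega m \<alpha> E"
  shows "FT \<xi> \<omega> = (\<integral>x. phase (\<xi> * f_map E \<omega> x) \<partial>lam)"
  unfolding FT_def fourier_transform_phase
  by (intro integral_distr lam_measurable f_map_measurable assms measurable_compose[OF _ phase_measurable]) simp

lemma norm_FT_le_1: "\<omega> \<in> Omega m \<alpha> E \<Longrightarrow> norm (FT \<xi> \<omega>) \<le> 1"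
  using FT_eq lam.norm_integral_phase_le by simp

lemma norm_FT_minus:
  assumes "\<omega> \<in> Omega m \<alpha> E"
  shows "norm (FT (- \<xi>) \<omega>) = norm (FT \<xi> \<omega>)"
proof -
  have "FT (- \<xi>) \<omega> = (\<integral>x. cnj (phase (\<xi> * f_map E \<omega> x)) \<partial>lam)"
    by (simp add: FT_eq[OF assms] cnj_phase)
  also have "\<dots> = cnj (FT \<xi> \<omega>)"
    unfolding FT_eq[OF assms] using lam_measurable[OF f_map_measurable[OF assms]]
    by (intro integral_bounded_linear[OF bounded_linear_cnj] lam.integrable_phase) auto
  finally show ?thesis by simp
qed

text \<open>On the bounded set \<open>E\<close> the map \<open>f_map E \<omega>\<close> is bounded
  uniformly in \<open>\<omega>\<close>, by \<open>f_map_bound\<close>, and \<open>phase\<close> is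
  Lipschitz with constant \<open>2 * pi\<close>.\<close>

lemma FT_lipschitz: "\<exists>L\<ge>0. \<forall>\<omega>\<in>Omega m \<alpha> E. \<forall>\<xi> \<zeta>. norm (FT \<xi> \<omega> - FT \<zeta> \<omega>) \<le> L * \<bar>\<xi> - \<zeta>\<bar>"
proof -
  obtain b where b: "\<And>x. x \<in> E \<Longrightarrow> \<bar>x\<bar> \<le> b"
    using compact_imp_bounded[OF E(1)] by (auto simp: bounded_real)
  define c where "c = \<bar>b\<bar> + \<bar>infsum gd (gaps E)\<bar>"
  have "norm (FT \<xi> \<omega> - FT \<zeta> \<omega>) \<le> 2 * pi * c * \<bar>\<xi> - \<zeta>\<bar>" if \<omega>: "\<omega> \<in> Omega m \<alpha> E" for \<omega> \<xi> \<zeta>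
  proof -
    have m: "f_map E \<omega> \<in> borel_measurable lam" by (intro lam_measurable f_map_measurable \<omega>)
    have i: "integrable lam (\<lambda>x. phase (\<xi> * f_map E \<omega> x))" for \<xi>
      using m by (intro lam.integrable_phase) auto
    have "FT \<xi> \<omega> - FT \<zeta> \<omega> = (\<integral>x. phase (\<xi> * f_map E \<omega> x) - phase (\<zeta> * f_map E \<omega> x) \<partial>lam)"
      unfolding FT_eq[OF \<omega>] by (intro Bochner_Integration.integral_diff[symmetric] i)
    also have "norm \<dots> \<le> (\<integral>x. norm (phase (\<xi> * f_map E \<omega> x) - phase (\<zeta> * f_map E \<omega> x)) \<partial>lam)"
      by (rule integral_norm_bound)
    also have "\<dots> \<le> (\<integral>x. 2 * pi * c * \<bar>\<xi> - \<zeta>\<bar> \<partial>lam)"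
    proof (intro integral_mono integrable_norm Bochner_Integration.integrable_diff i lam.integrable_const)
      fix x assume "x \<in> space lam"
      then have "\<bar>f_map E \<omega> x\<bar> \<le> c"
        using f_map_bound[OF \<omega>, of x] b[of x] by (simp add: space_lam c_def)
      then have "2 * pi * (\<bar>\<xi> - \<zeta>\<bar> * \<bar>f_map E \<omega> x\<bar>) \<le> 2 * pi * (\<bar>\<xi> - \<zeta>\<bar> * c)"
        by (intro mult_left_mono) auto
      moreover have "\<bar>\<xi> * f_map E \<omega> x - \<zeta> * f_map E \<omega> x\<bar> = \<bar>\<xi> - \<zeta>\<bar> * \<bar>f_map E \<omega> x\<bar>"
        by (simp add: left_diff_distrib[symmetric] abs_mult)
      ultimately have "norm (phase (\<xi> * f_map E \<omega> x) - phase (\<zeta> * f_map E \<omega> x)) \<le> 2 * pi * (\<bar>\<xi> - \<zeta>\<bar> * c)"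
        by (intro order_trans[OF norm_phase_diff_le]) simp
      then show "norm (phase (\<xi> * f_map E \<omega> x) - phase (\<zeta> * f_map E \<omega> x)) \<le> 2 * pi * c * \<bar>\<xi> - \<zeta>\<bar>"
        by (simp add: mult_ac)
    qed
    also have "\<dots> = 2 * pi * c * \<bar>\<xi> - \<zeta>\<bar>" by (simp add: lam.prob_space)
    finally show ?thesis .
  qed
  moreover have "2 * pi * c \<ge> 0" by (simp add: c_def)
  ultimately show ?thesis by blast
qed

lemma finite_T: "finite (T n)"
  unfolding T_def by (intro finite_large_gaps E) auto

lemma T_subset: "T n \<subseteq> gaps E"
  by (auto simp: T_def)

lemma eventually_subset_T:
  assumes "finite X" "X \<subseteq> gaps E"
  shows "eventually (\<lambda>n. X \<subseteq> T n) sequentially"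
proof -
  have "eventually (\<lambda>n. U \<in> T n) sequentially" if "U \<in> X" for U
  proof -
    have U: "U \<in> gaps E" using that assms by auto
    have "(\<lambda>n. 1 / real (Suc n)) \<longlonglongrightarrow> 0" by (rule LIMSEQ_Suc[OF lim_1_over_n])
    then have "eventually (\<lambda>n. 1 / real (Suc n) < len U) sequentially"
      using len_gap_pos[OF E U] by (rule order_tendstoD)
    then show ?thesis by eventually_elim (use U in \<open>auto simp: T_def\<close>)
  qed
  then have "eventually (\<lambda>n. \<forall>U\<in>X. U \<in> T n) sequentially"
    using assms(1) by (simp add: eventually_ball_finite)
  then show ?thesis by eventually_elim auto
qed

text \<open>Summation is a limit along the finite sets of gaps, and \<open>T\<close> is cofinal
  among these by \<open>eventually_subset_T\<close>.\<close>

lemma truncation_tendsto: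
  assumes \<omega>: "\<omega> \<in> Omega m \<alpha> E"
  shows "(\<lambda>n. x + (\<Sum>U\<in>T n. of_bool (U \<subseteq> {..<x}) * \<omega> U)) \<longlonglongrightarrow> f_map E \<omega> x"
proof -
  define G where "G = {U \<in> gaps E. U \<subseteq> {..<x}}"
  have "(\<omega> has_sum infsum \<omega> G) G"
    by (intro has_sum_infsum summable_Omega \<omega>) (auto simp: G_def)
  then have "((\<lambda>U. of_bool (U \<subseteq> {..<x}) * \<omega> U) has_sum infsum \<omega> G) (gaps E)"
    by (rule has_sum_cong_neutral[THEN iffD1, rotated -1]) (auto simp: G_def)
  then have "(sum (\<lambda>U. of_bool (U \<subseteq> {..<x}) * \<omega> U) \<longlongrightarrow> infsum \<omega> G) (finite_subsets_at_top (gaps E))"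
    by (simp add: has_sum_def)
  moreover have "filterlim T (finite_subsets_at_top (gaps E)) sequentially"
    unfolding filterlim_finite_subsets_at_top using eventually_subset_T finite_T T_subset by auto
  ultimately have "(\<lambda>n. \<Sum>U\<in>T n. of_bool (U \<subseteq> {..<x}) * \<omega> U) \<longlonglongrightarrow> infsum \<omega> G"
    by (rule filterlim_compose)
  then show ?thesis
    unfolding f_map_def G_def[symmetric] by (intro tendsto_intros)
qed

definition FTn :: "nat \<Rightarrow> real \<Rightarrow> (real set \<Rightarrow> real) \<Rightarrow> complex" where
  "FTn n \<xi> \<omega> = (\<integral>x. phase (\<xi> * (x + (\<Sum>U\<in>T n. of_bool (U \<subseteq> {..<x}) * \<omega> U))) \<partial>lam)"

lemma space_PiM_K: "space (PiM (gaps E) K) = Omega m \<alpha> E"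
  using space_P_measure[of m \<alpha> E \<nu>] by (simp add: P_measure_eq)

lemma FTn_tendsto:
  assumes \<omega>: "\<omega> \<in> Omega m \<alpha> E"
  shows "(\<lambda>n. FTn n \<xi> \<omega>) \<longlonglongrightarrow> FT \<xi> \<omega>"
  unfolding FTn_def FT_eq[OF \<omega>]
proof (rule integral_dominated_convergence[where w = "\<lambda>_. 1"])
  show "(\<lambda>x. phase (\<xi> * f_map E \<omega> x)) \<in> borel_measurable lam"
    using lam_measurable[OF f_map_measurable[OF \<omega>]] by measurable
  show "(\<lambda>x. phase (\<xi> * (x + (\<Sum>U\<in>T n. of_bool (U \<subseteq> {..<x}) * \<omega> U)))) \<in> borel_measurable lam" for n
    by (intro lam_measurable) (simp add: of_bool_def)
  have "isCont phase x" for x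
    using continuous_on_phase[OF continuous_on_id, of UNIV] by (simp add: continuous_on_eq_continuous_at)
  then show "AE x in lam. (\<lambda>n. phase (\<xi> * (x + (\<Sum>U\<in>T n. of_bool (U \<subseteq> {..<x}) * \<omega> U)))) \<longlonglongrightarrow> phase (\<xi> * f_map E \<omega> x)"
    by (intro AE_I2 isCont_tendsto_compose[of _ phase] tendsto_mult_left truncation_tendsto \<omega>)
qed auto

lemma FTn_measurable: "FTn n \<xi> \<in> borel_measurable (PiM (gaps E) K)"
  unfolding FTn_def
  by (intro transform_measurable lam.sigma_finite_measure_axioms lam_measurable K_measurable T_subset left_of_pred) auto

lemma FT_measurable: "FT \<xi> \<in> borel_measurable (PiM (gaps E) K)"
  by (rule borel_measurable_LIMSEQ_metric[OF FTn_measurable FTn_tendsto]) (simp add: space_PiM_K)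

text \<open>Once \<open>S \<subseteq> T n\<close>, the bound for the truncated transform is
  independent of \<open>n\<close>, and Fatou's lemma carries it to the limit.\<close>

lemma moment_FT:
  assumes "separated_measure lam S (\<lambda>U x. U \<subseteq> {..<x}) r B" and S: "finite S" "S \<subseteq> gaps E"
    and half: "\<And>U k. U \<in> S \<Longrightarrow> k \<noteq> 0 \<Longrightarrow> norm (fourier_transform \<nu> (\<xi> * of_int k * gd U)) \<le> 1/2"
  shows "(\<integral>\<^sup>+\<omega>. ennreal (norm (FT \<xi> \<omega>) ^ (2 * q)) \<partial>PiM (gaps E) K) \<le> ennreal (fact (2 * q) * (4 * B) ^ q)"
proof -
  interpret sm: separated_measure lam S "\<lambda>U x. U \<subseteq> {..<x}" r B by fact
  have "(\<integral>\<^sup>+\<omega>. ennreal (norm (FT \<xi> \<omega>) ^ (2 * q)) \<partial>PiM (gaps E) K)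
    = (\<integral>\<^sup>+\<omega>. liminf (\<lambda>n. ennreal (norm (FTn n \<xi> \<omega>) ^ (2 * q))) \<partial>PiM (gaps E) K)"
  proof (intro nn_integral_cong lim_imp_Liminf[symmetric])
    fix \<omega> assume "\<omega> \<in> space (PiM (gaps E) K)"
    then show "(\<lambda>n. ennreal (norm (FTn n \<xi> \<omega>) ^ (2 * q))) \<longlonglongrightarrow> ennreal (norm (FT \<xi> \<omega>) ^ (2 * q))"
      by (intro tendsto_ennrealI tendsto_power tendsto_norm FTn_tendsto) (simp add: space_PiM_K)
  qed simp
  also have "\<dots> \<le> liminf (\<lambda>n. \<integral>\<^sup>+\<omega>. ennreal (norm (FTn n \<xi> \<omega>) ^ (2 * q)) \<partial>PiM (gaps E) K)"
    using FTn_measurable by (intro nn_integral_liminf) measurable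
  also have "\<dots> \<le> ennreal (fact (2 * q) * (4 * B) ^ q)"
  proof (intro Liminf_le)
    show "\<forall>\<^sub>F n in sequentially. (\<integral>\<^sup>+\<omega>. ennreal (norm (FTn n \<xi> \<omega>) ^ (2 * q)) \<partial>PiM (gaps E) K) \<le> ennreal (fact (2 * q) * (4 * B) ^ q)"
      using eventually_subset_T[OF S]
    proof eventually_elim
      case (elim n)
      show ?case unfolding FTn_def
        using elim finite_T T_subset left_of_pred half
        by (intro sm.moment_bound prob_space_K K_measurable) (auto simp: integral_phase_K)
    qed
  qed simp
  finally show ?thesis .
qed

end

section \<open>Almost sure decay of the random transform\<close>

context random_image
begin

lemma moment_decay:
  assumes \<kappa>: "\<kappa> > 0" and porous: "\<And>a b. a \<in> E \<Longrightarrow> b \<in> E \<Longrightarrow> a < b \<Longrightarrow> \<exists>U\<in>gaps E. U \<subseteq> {a<..<b} \<and> \<kappa> * (b - a) \<le> len U"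
    and \<nu>_decay: "(fourier_transform \<nu> \<longlongrightarrow> 0) at_infinity"
    and regular: "\<And>I. is_interval I \<Longrightarrow> bounded I \<Longrightarrow> measure lam (I \<inter> E) \<le> A * rpow (len I) s"
    and s: "s > 0" and c: "c > 0" "\<And>U. U \<in> gaps E \<Longrightarrow> c * len U powr D \<le> gd U" and D: "D > 0"
  shows "\<exists>C\<ge>0. \<forall>q. \<forall>\<xi>>0. (\<integral>\<^sup>+\<omega>. ennreal (norm (FT \<xi> \<omega>) ^ (2 * q)) \<partial>PiM (gaps E) K)
    \<le> ennreal (fact (2 * q) * (C * \<xi> powr (- (s / D))) ^ q)"
proof -
  have "eventually (\<lambda>x. norm (fourier_transform \<nu> x) < 1/2) at_infinity"
    using tendstoD[OF \<nu>_decay, of "1/2"] by (simp add: dist_norm)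
  then obtain R0 where R0: "\<And>x::real. R0 \<le> norm x \<Longrightarrow> norm (fourier_transform \<nu> x) < 1/2"
    by (auto simp: eventually_at_infinity)
  define R where "R = max 1 R0"
  have R: "R > 0" "\<And>x. R \<le> \<bar>x\<bar> \<Longrightarrow> norm (fourier_transform \<nu> x) \<le> 1/2"
    using R0 by (auto simp: R_def less_imp_le)
  define C where "C = 4 * (\<bar>A\<bar> * (\<kappa> powr (- s) * (R / c) powr (s / D)))"
  have "(\<integral>\<^sup>+\<omega>. ennreal (norm (FT \<xi> \<omega>) ^ (2 * q)) \<partial>PiM (gaps E) K)
    \<le> ennreal (fact (2 * q) * (C * \<xi> powr (- (s / D))) ^ q)" if \<xi>: "\<xi> > 0" for q \<xi>
  proof -
    \<comment> \<open>The solution of \<open>\<xi> * (c * \<rho> powr D) = R\<close>. For a gap of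
      length at least \<open>\<rho>\<close> it places the frequency \<open>\<xi> * gd U\<close>
      beyond the threshold \<open>R\<close>, where the transform of \<open>\<nu>\<close> is at most
      \<open>1/2\<close>.\<close>
    define \<rho> where "\<rho> = (R / (c * \<xi>)) powr (1 / D)"
    define S where "S = {U \<in> gaps E. \<rho> \<le> len U}"
    define r where "r = \<rho> / \<kappa>"
    define B where "B = \<bar>A\<bar> * r powr s"
    have \<rho>: "\<rho> > 0" using R c \<xi> by (simp add: \<rho>_def)
    have "finite S" unfolding S_def by (intro finite_large_gaps E \<rho>)
    have sep: "separated_measure lam S (\<lambda>U x. U \<subseteq> {..<x}) r B"
    proof (intro separated_measure.intro lam.prob_space_axioms separated_measure_axioms.intro)
      show "sets lam = sets (restrict_space borel (space lam))" by (simp add: sets_lam space_lam)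
      show "finite S" by fact
      show "\<And>u. Measurable.pred lam (\<lambda>x. u \<subseteq> {..<x})" by (rule left_of_pred)
      show "\<And>u x y. x \<le> y \<Longrightarrow> u \<subseteq> {..<x} \<Longrightarrow> u \<subseteq> {..<y::real}" by (auto intro: less_le_trans)
      show "y - x \<le> r" if "x \<in> space lam" "y \<in> space lam" "x \<le> y" "\<And>u. u \<in> S \<Longrightarrow> u \<subseteq> {..<x} \<longleftrightarrow> u \<subseteq> {..<y}" for x y
      proof (cases "x < y")
        case True
        have xy: "x \<in> E" "y \<in> E" using that(1,2) by (simp_all add: space_lam)
        obtain U where U: "U \<in> gaps E" "U \<subseteq> {x<..<y}" "\<kappa> * (y - x) \<le> len U"
          using porous[OF xy True] by blast
        \<comment> \<open>An empty \<open>U\<close> would also lie to the left of \<open>x\<close>;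
          positive length is what makes the gap separate \<open>x\<close> from
          \<open>y\<close>.\<close>
        have "U \<noteq> {}" using len_gap_pos[OF E U(1)] by auto
        then have "\<not> U \<subseteq> {..<x}" using U(2) by fastforce
        moreover have "U \<subseteq> {..<y}" using U(2) by auto
        ultimately have "U \<notin> S" using that(4) by blast
        then have "\<kappa> * (y - x) \<le> \<rho>" using U by (simp add: S_def)
        then show ?thesis using \<kappa> by (simp add: r_def field_simps)
      next
        case False
        then show ?thesis using that(3) \<rho> \<kappa> by (simp add: r_def)
      qed
      show "measure lam ({p..q} \<inter> space lam) \<le> B" if "p \<le> q" "q - p \<le> r" for p q
      proof -
        have "measure lam ({p..q} \<inter> space lam) \<le> A * rpow (len {p..q}) s"
          unfolding space_lam by (intro regular) auto
        also have "\<dots> = A * (q - p) powr s" using that s by (simp add: rpow_def)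
        also have "\<dots> \<le> \<bar>A\<bar> * r powr s"
          using that s by (intro mult_mono powr_mono2) auto
        finally show ?thesis by (simp add: B_def)
      qed
    qed
    have half: "norm (fourier_transform \<nu> (\<xi> * of_int k * gd U)) \<le> 1/2" if "U \<in> S" "k \<noteq> 0" for U k
    proof (rule R(2))
      have "R / \<xi> = c * \<rho> powr D"
        using R c \<xi> D by (simp add: \<rho>_def powr_powr)
      also have "\<dots> \<le> c * len U powr D"
        using that \<rho> c D by (intro mult_left_mono powr_mono2) (auto simp: S_def)
      also have "\<dots> \<le> gd U" using that by (intro c) (auto simp: S_def)
      finally have "R \<le> \<xi> * gd U" using \<xi> by (simp add: field_simps)
      also have "\<dots> = \<xi> * 1 * gd U" by simp
      also have "\<dots> \<le> \<xi> * \<bar>of_int k\<bar> * gd U"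
        using that \<xi> gap_delta_nonneg by (intro mult_right_mono mult_left_mono) auto
      finally show "R \<le> \<bar>\<xi> * of_int k * gd U\<bar>" using \<xi> gap_delta_nonneg[of m \<alpha> U] by (simp add: abs_mult)
    qed
    have "r powr s = \<kappa> powr (- s) * (R / (c * \<xi>)) powr (s / D)"
      using \<kappa> R c \<xi> by (simp add: r_def \<rho>_def powr_divide powr_mult powr_powr powr_minus_divide)
    also have "(R / (c * \<xi>)) powr (s / D) = (R / c) powr (s / D) * \<xi> powr (- (s / D))"
      using R c \<xi> by (simp add: powr_divide powr_mult powr_minus_divide)
    finally have "4 * B = C * \<xi> powr (- (s / D))" by (simp add: B_def C_def)
    then show ?thesis
      using moment_FT[OF sep \<open>finite S\<close> _ half, of q] by (auto simp: S_def)
  qed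
  moreover have "C \<ge> 0" by (simp add: C_def)
  ultimately show ?thesis by blast
qed

lemma decay_AE:
  assumes \<kappa>: "\<kappa> > 0" and porous: "\<And>a b. a \<in> E \<Longrightarrow> b \<in> E \<Longrightarrow> a < b \<Longrightarrow> \<exists>U\<in>gaps E. U \<subseteq> {a<..<b} \<and> \<kappa> * (b - a) \<le> len U"
    and \<nu>_decay: "(fourier_transform \<nu> \<longlongrightarrow> 0) at_infinity"
    and regular: "\<And>I. is_interval I \<Longrightarrow> bounded I \<Longrightarrow> measure lam (I \<inter> E) \<le> A * rpow (len I) s"
    and s: "s > 0" and p: "0 < p" "p \<le> 1" "p < s / (real m + \<alpha>)"
  shows "AE \<omega> in PiM (gaps E) K. bounded (range (\<lambda>\<xi>. norm (FT \<xi> \<omega>) * rpow \<bar>\<xi>\<bar> (p / 2)))"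
proof -
  interpret P: prob_space "PiM (gaps E) K" by (intro prob_space_PiM prob_space_K)
  define w where "w = s / p"
  \<comment> \<open>Half of the slack, so that \<open>D\<close> is the midpoint of
    \<open>real m + \<alpha>\<close> and \<open>s / p\<close>. Then the decay exponent
    \<open>t = s / D\<close> of the moments exceeds \<open>p\<close>.\<close>
  define \<eta> where "\<eta> = (w - (real m + \<alpha>)) / 2"
  have a: "real m + \<alpha> > 0" using m \<alpha> by linarith
  have ps: "real m + \<alpha> < w" using p a by (simp add: w_def field_simps)
  then have \<eta>: "\<eta> > 0" by (simp add: \<eta>_def)
  define D where "D = real m + \<alpha> + \<eta>"
  have "D < w" using ps unfolding D_def \<eta>_def by (simp add: field_simps)
  moreover have "D > 0" using a \<eta> unfolding D_def by linarith
  ultimately have D: "D > 0" "D < w" by auto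
  define t where "t = s / D"
  have t: "p < t" using D p by (simp add: t_def w_def field_simps)
  obtain c where c: "c > 0" "\<And>U. U \<in> gaps E \<Longrightarrow> c * len U powr D \<le> gd U"
    using gap_delta_ge[OF E \<alpha> \<eta>, of m] unfolding D_def by blast
  obtain C where C: "C \<ge> 0" and mom: "\<And>q \<xi>. \<xi> > 0 \<Longrightarrow>
      (\<integral>\<^sup>+\<omega>. ennreal (norm (FT \<xi> \<omega>) ^ (2 * q)) \<partial>PiM (gaps E) K) \<le> ennreal (fact (2 * q) * (C * \<xi> powr (- t)) ^ q)"
    using moment_decay[OF \<kappa> porous \<nu>_decay regular s c D(1)] unfolding t_def by blast
  \<comment> \<open>The moment of order \<open>2q\<close> of \<open>Y k\<close> is of order
    \<open>k powr (- ((t - p) * q) / 2)\<close>, and this \<open>q\<close> makes it summable with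
    room to spare, at most of order \<open>k powr (- 2)\<close>.\<close>
  define q where "q = nat \<lceil>4 / (t - p)\<rceil>"
  have "4 / (t - p) > 0" using t by simp
  then have q: "q > 0" "4 / (t - p) \<le> real q" unfolding q_def by linarith+
  then have qt: "4 \<le> (t - p) * real q" using t by (simp add: field_simps)
  define Y where "Y k \<omega> = norm (FT (sqrt (real k)) \<omega>) * real k powr (p / 4)" for k \<omega>
  have "AE \<omega> in PiM (gaps E) K. \<exists>c. \<forall>k\<ge>1. Y k \<omega> \<le> c"
  proof (rule P.AE_bounded_from_moments)
    show "Y k \<in> borel_measurable (PiM (gaps E) K)" for k
      unfolding Y_def using FT_measurable by measurable
    show "0 \<le> Y k \<omega>" for k \<omega> by (simp add: Y_def)
    show "(\<integral>\<^sup>+\<omega>. ennreal (Y k \<omega> ^ (2 * q)) \<partial>PiM (gaps E) K) \<le> ennreal (fact (2 * q) * C ^ q * real k powr (- 2))" if k: "k \<ge> 1" for k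
    proof -
      have pw: "(real k powr (p / 4)) ^ (2 * q) = real k powr (p * real q / 2)"
        using k by (simp add: powr_realpow[symmetric] powr_powr)
      have "sqrt (real k) powr (- t) = real k powr (- t / 2)"
        using k by (simp add: powr_half_sqrt[symmetric] powr_powr)
      then have pw2: "(sqrt (real k) powr (- t)) ^ q = real k powr (- t * real q / 2)"
        using k by (simp add: powr_realpow[symmetric] powr_powr)
      have "(\<integral>\<^sup>+\<omega>. ennreal (Y k \<omega> ^ (2 * q)) \<partial>PiM (gaps E) K)
        = (\<integral>\<^sup>+\<omega>. ennreal (norm (FT (sqrt (real k)) \<omega>) ^ (2 * q)) * ennreal (real k powr (p * real q / 2)) \<partial>PiM (gaps E) K)"
        unfolding Y_def power_mult_distrib pw by (simp add: ennreal_mult)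
      also have "\<dots> = (\<integral>\<^sup>+\<omega>. ennreal (norm (FT (sqrt (real k)) \<omega>) ^ (2 * q)) \<partial>PiM (gaps E) K) * ennreal (real k powr (p * real q / 2))"
        using FT_measurable by (intro nn_integral_multc) measurable
      also have "\<dots> \<le> ennreal (fact (2 * q) * (C * sqrt (real k) powr (- t)) ^ q) * ennreal (real k powr (p * real q / 2))"
        using k by (intro mult_right_mono mom) auto
      also have "\<dots> = ennreal (fact (2 * q) * C ^ q * (real k powr (- t * real q / 2) * real k powr (p * real q / 2)))"
        using C unfolding power_mult_distrib pw2 by (simp add: ennreal_mult[symmetric] mult_ac)
      also have "real k powr (- t * real q / 2) * real k powr (p * real q / 2) = real k powr (- ((t - p) * real q) / 2)"
        by (simp add: powr_add[symmetric] algebra_simps diff_divide_distrib)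
      also have "ennreal (fact (2 * q) * C ^ q * real k powr (- ((t - p) * real q) / 2)) \<le> ennreal (fact (2 * q) * C ^ q * real k powr (- 2))"
        using k C qt by (intro ennreal_leI mult_left_mono powr_mono) auto
      finally show ?thesis .
    qed
    show "q > 0" "0 \<le> fact (2 * q) * C ^ q" using q C by auto
  qed
  then have "AE \<omega> in PiM (gaps E) K. \<omega> \<in> Omega m \<alpha> E \<and> (\<exists>c. \<forall>k\<ge>1. Y k \<omega> \<le> c)"
    using AE_space by eventually_elim (auto simp: space_PiM_K)
  then show ?thesis
  proof eventually_elim
    case (elim \<omega>)
    then have \<omega>: "\<omega> \<in> Omega m \<alpha> E" by simp
    obtain c where c: "\<And>k. k \<ge> 1 \<Longrightarrow> Y k \<omega> \<le> c" using elim by blast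
    obtain L where L: "L \<ge> 0" "\<And>\<xi> \<zeta>. norm (FT \<xi> \<omega> - FT \<zeta> \<omega>) \<le> L * \<bar>\<xi> - \<zeta>\<bar>"
      using FT_lipschitz \<omega> by blast
    show ?case
    proof (rule decay_from_sqrt_grid[where L = L and C = c])
      show "\<bar>norm (FT \<xi> \<omega>) - norm (FT \<zeta> \<omega>)\<bar> \<le> L * \<bar>\<xi> - \<zeta>\<bar>" for \<xi> \<zeta>
        using L(2) norm_triangle_ineq3 order_trans by blast
      show "norm (FT (sqrt (real k)) \<omega>) * real k powr (p / 4) \<le> c" if "k \<ge> 1" for k
        using c[OF that] by (simp add: Y_def)
    qed (use \<omega> norm_FT_le_1 norm_FT_minus L p in auto)
  qed
qed

lemma fourier_dim_ge:
  assumes "\<omega> \<in> Omega m \<alpha> E" "p \<in> {0..1}"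
    "bounded (range (\<lambda>\<xi>. norm (FT \<xi> \<omega>) * rpow \<bar>\<xi>\<bar> (p / 2)))"
  shows "p \<le> fourier_dim (distr lam borel (f_map E \<omega>))"
  unfolding fourier_dim_def using assms(2,3)
  by (intro cSup_upper bdd_aboveI[of _ 1]) (auto simp: FT_def)

lemma fourier_dim_nonneg:
  assumes "\<omega> \<in> Omega m \<alpha> E"
  shows "0 \<le> fourier_dim (distr lam borel (f_map E \<omega>))"
proof (rule fourier_dim_ge[OF assms])
  show "bounded (range (\<lambda>\<xi>. norm (FT \<xi> \<omega>) * rpow \<bar>\<xi>\<bar> (0 / 2)))"
    using norm_FT_le_1[OF assms] by (intro boundedI[of _ 1]) (auto simp: rpow_def)
qed simp

end

theorem theorem4:
  fixes m N :: nat and \<alpha> \<beta> s A :: real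
    and F :: "nat \<Rightarrow> real \<Rightarrow> real" and E :: "real set"
    and \<nu> lam :: "real measure"
  assumes "m > 0" and "\<alpha> \<in> {0..1}" and "\<beta> > 0"
    and "\<And>i. i \<in> {1..N} \<Longrightarrow> contracting (F i) \<and> C1_holder_diffeo \<beta> (F i)"
    and "is_attractor N F E"
    and "\<And>i j. i \<in> {1..N} \<Longrightarrow> j \<in> {1..N} \<Longrightarrow> i \<noteq> j \<Longrightarrow>
           interior (convex hull (F i ` E)) \<inter> interior (convex hull (F j ` E)) = {}"
    and "\<nexists>a b. a < b \<and> E = {a..b}"
    and "borel_prob_on {0..1} \<nu>"
    and "(fourier_transform \<nu> \<longlongrightarrow> 0) at_infinity"
    and "s \<in> {0..1}"
    and "borel_prob_on E lam"
    and "\<And>I. is_interval I \<Longrightarrow> bounded I \<Longrightarrow> measure lam (I \<inter> E) \<le> A * rpow (len I) s"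
  shows "AE \<omega> in P_measure m \<alpha> E \<nu>.
           fourier_dim (distr lam borel (f_map E \<omega>)) \<ge> s / (real m + \<alpha>)"
proof -
  interpret random_image m \<alpha> E \<nu> lam
    using assms by unfold_locales (auto simp: is_attractor_def)
  have in_Omega: "AE \<omega> in PiM (gaps E) K. \<omega> \<in> Omega m \<alpha> E"
    using AE_space by eventually_elim (simp add: space_PiM_K)
  show ?thesis
  proof (cases "s = 0")
    \<comment> \<open>The exponent 0 always belongs to the set that defines
      \<open>fourier_dim\<close>, as the transform is bounded by 1.\<close>
    case True
    show ?thesis
      unfolding P_measure_eq using in_Omega by eventually_elim (simp add: True fourier_dim_nonneg)
  next
    case False
    then have s: "s > 0" using assms(10) by simp
    obtain \<kappa> where \<kappa>: "\<kappa> > 0"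
      "\<forall>a\<in>E. \<forall>b\<in>E. a < b \<longrightarrow> (\<exists>U\<in>gaps E. U \<subseteq> {a<..<b} \<and> \<kappa> * (b - a) \<le> len U)"
      using attractor_porous[OF assms(3-7)] by blast
    define d where "d = s / (real m + \<alpha>)"
    \<comment> \<open>This yields \<open>d \<le> 1\<close>; exponents above 1 are excluded from the
      supremum in \<open>fourier_dim\<close>.\<close>
    have "real m + \<alpha> \<ge> 1" using assms(1,2) by auto
    then have d: "0 < d" "d \<le> 1" using s assms(10) by (auto simp: d_def field_simps)
    \<comment> \<open>\<open>decay_AE\<close> requires an exponent strictly below \<open>d\<close>.
      A sequence tending to \<open>d\<close> involves only countably many null sets, and
      \<open>Suc (Suc n)\<close> keeps already \<open>p 0\<close> positive.\<close>
    define p where "p n = d * (1 - 1 / real (Suc (Suc n)))" for n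
    have p: "0 < p n" "p n < d" for n
    proof -
      have "0 < d * (1 / real (Suc (Suc n)))" "d * (1 / real (Suc (Suc n))) < d * 1"
        using d by (intro mult_pos_pos mult_strict_left_mono; simp)+
      then show "0 < p n" "p n < d" unfolding p_def right_diff_distrib by linarith+
    qed
    have "AE \<omega> in PiM (gaps E) K. \<forall>n. bounded (range (\<lambda>\<xi>. norm (FT \<xi> \<omega>) * rpow \<bar>\<xi>\<bar> (p n / 2)))"
      unfolding AE_all_countable
    proof
      fix n
      show "AE \<omega> in PiM (gaps E) K. bounded (range (\<lambda>\<xi>. norm (FT \<xi> \<omega>) * rpow \<bar>\<xi>\<bar> (p n / 2)))"
        using p[of n] d \<kappa>(2)
        by (intro decay_AE[OF \<kappa>(1) _ assms(9) assms(12) s]) (auto simp: d_def)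
    qed
    then show ?thesis
      unfolding P_measure_eq d_def[symmetric] using in_Omega
    proof eventually_elim
      case (elim \<omega>)
      have "p n \<le> fourier_dim (distr lam borel (f_map E \<omega>))" for n
        using elim p[of n] d by (intro fourier_dim_ge) auto
      moreover have "p \<longlonglongrightarrow> d * (1 - 0)"
        unfolding p_def by (intro tendsto_intros LIMSEQ_Suc lim_1_over_n)
      ultimately show "d \<le> fourier_dim (distr lam borel (f_map E \<omega>))"
        by (intro LIMSEQ_le_const2[of p]) auto
    qed
  qed
qed

end
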